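(* There exists an absolute constant $C>0$ such that for all integers $k\ge 2$ and $n$ with $k<n/2$, $$\operatorname{rank}^{\pm}(\mathrm{GHD}_k^n)\ \ge\ \Bigl(1-C\sqrt{\tfrac{\log k}{k}}\Bigr)\cdot 2k .$$
   Context: For integers $k<n/2$, the Gap Hamming Distance matrix $\mathrm{GHD}_k^n$ is the $2^n\times 2^n$ partial sign matrix with rows and columns indexed by $\{0,1\}^n$, with entries in $\{-1,1,*\}$, given by $\mathrm{GHD}_k^n(x,y)=1$ if $d_H(x,y)\le k$, $\mathrm{GHD}_k^n(x,y)=-1$ if $d_H(x,y)\ge n-k$, and $\mathrm{GHD}_k^n(x,y)=*$ otherwise, where $d_H$ is Hamming distance. The sign-rank $\operatorname{rank}^{\pm}(A)$ of a partial sign matrix $A\in\{-1,1,*\}^{M\times N}$ is the smallest integer $d$ for which there exist nonzero vectors $u_1,\dots,u_M\in\mathbb{R}^d$ and $v_1,\dots,v_N\in\mathbb{R}^d$ such that $\operatorname{sign}(\langle u_i,v_j\rangle)=A_{ij}$ for every $(i,j)$ with $A_{ij}\in\{-1,1\}$ (no condition where $A_{ij}=*$). *)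

theory Defs
  imports "HOL-Analysis.Analysis"
begin

datatype sign_entry = Plus | Minus | Star

type_synonym ('r, 'c) partial_sign_matrix = "'r \<Rightarrow> 'c \<Rightarrow> sign_entry"

text \<open>A vector of $\mathbb{R}^d$ is a function \<open>nat \<Rightarrow> real\<close> of which only the coordinates below \<open>d\<close>
  count; a matrix is given together with its row index set \<open>R\<close> and column index set \<open>S\<close>.\<close>

definition inner_prod :: "nat \<Rightarrow> (nat \<Rightarrow> real) \<Rightarrow> (nat \<Rightarrow> real) \<Rightarrow> real" where
  "inner_prod d u v = (\<Sum>t<d. u t * v t)"

definition nonzero_vec :: "nat \<Rightarrow> (nat \<Rightarrow> real) \<Rightarrow> bool" where
  "nonzero_vec d u \<longleftrightarrow> (\<exists>t<d. u t \<noteq> 0)"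

definition sign_representable ::
    "'r set \<Rightarrow> 'c set \<Rightarrow> ('r, 'c) partial_sign_matrix \<Rightarrow> nat \<Rightarrow> bool" where
  "sign_representable R S A d \<longleftrightarrow>
     (\<exists>u v. (\<forall>i\<in>R. nonzero_vec d (u i)) \<and> (\<forall>j\<in>S. nonzero_vec d (v j)) \<and>
        (\<forall>i\<in>R. \<forall>j\<in>S. (A i j = Plus \<longrightarrow> sgn (inner_prod d (u i) (v j)) = 1) \<and>
                     (A i j = Minus \<longrightarrow> sgn (inner_prod d (u i) (v j)) = -1)))"

definition sign_rank :: "'r set \<Rightarrow> 'c set \<Rightarrow> ('r, 'c) partial_sign_matrix \<Rightarrow> nat" where
  "sign_rank R S A = (LEAST d. sign_representable R S A d)"

text \<open>The minimum is attained when \<open>S\<close> is finite.\<close>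

lemma sign_representable_finite:
  assumes "finite S"
  shows "\<exists>d. sign_representable R S A d"
proof -
  obtain f where f: "bij_betw f S {0..<card S}"
    using ex_bij_betw_finite_nat[OF assms] by blast
  define g where "g = inv_into S f"
  define u where "u = (\<lambda>i t. if t < card S \<and> A i (g t) = Minus then -1 else 1 :: real)"
  define v where "v = (\<lambda>j t. if t = f j then 1 else 0 :: real)"
  have f_lt: "f j < card S" if "j \<in> S" for j
    using f that by (auto simp: bij_betw_def)
  have g_f: "g (f j) = j" if "j \<in> S" for j
    using f that by (simp add: g_def bij_betw_def)
  have ip: "inner_prod (Suc (card S)) (u i) (v j) = (if A i j = Minus then -1 else 1)"
    if "j \<in> S" for i j
  proof -
    have "inner_prod (Suc (card S)) (u i) (v j) = (\<Sum>t<Suc (card S). if t = f j then u i t else 0)"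
      unfolding inner_prod_def v_def by (intro sum.cong) auto
    also have "\<dots> = u i (f j)"
      using f_lt[OF that] by (simp add: sum.delta del: sum.lessThan_Suc)
    finally show ?thesis
      using f_lt[OF that] g_f[OF that] by (simp add: u_def)
  qed
  have "nonzero_vec (Suc (card S)) (u i)" for i
    unfolding nonzero_vec_def by (rule exI[of _ "card S"]) (simp add: u_def)
  moreover have "nonzero_vec (Suc (card S)) (v j)" if "j \<in> S" for j
    unfolding nonzero_vec_def using f_lt[OF that] by (intro exI[of _ "f j"]) (simp add: v_def)
  ultimately have "sign_representable R S A (Suc (card S))"
    unfolding sign_representable_def by (intro exI[of _ u] exI[of _ v]) (auto simp: ip)
  then show ?thesis by blast
qed

lemma sign_representable_sign_rank:
  assumes "finite S"
  shows "sign_representable R S A (sign_rank R S A)"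
  unfolding sign_rank_def using sign_representable_finite[OF assms] by (rule LeastI_ex)

definition cube :: "nat \<Rightarrow> (nat \<Rightarrow> nat) set" where
  "cube n = {..<n} \<rightarrow>\<^sub>E {0, 1}"

definition hamming_dist :: "nat \<Rightarrow> (nat \<Rightarrow> nat) \<Rightarrow> (nat \<Rightarrow> nat) \<Rightarrow> nat" where
  "hamming_dist n x y = card {i. i < n \<and> x i \<noteq> y i}"

text \<open>Only meaningful for \<open>2 * k < n\<close>: the two distance ranges are then disjoint and \<open>n - k\<close> does not
  truncate.\<close>

definition GHD :: "nat \<Rightarrow> nat \<Rightarrow> (nat \<Rightarrow> nat, nat \<Rightarrow> nat) partial_sign_matrix" where
  "GHD k n x y =
     (if hamming_dist n x y \<le> k then Plus
      else if hamming_dist n x y \<ge> n - k then Minus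
      else Star)"

end

theory Submission
  imports Defs "HOL-Library.Z2"
begin

text \<open>
  Suppose that vectors \<open>u x\<close>, \<open>v y\<close> in \<open>\<real>\<^sup>d\<close> represent the matrix, where \<open>d < n\<close>
  may be assumed because \<open>2 * k < n\<close>. Put
  \<open>w x = u x - u x'\<close>, with \<open>x'\<close> the antipode of \<open>x\<close> in the cube. If \<open>y\<close> is within distance \<open>k\<close> of
  \<open>x\<close>, it is at distance at least \<open>n - k\<close> from \<open>x'\<close>, and so \<open>w x\<close> has positive inner product with
  \<open>v y\<close>. Thus a set of vertices inside a Hamming ball of radius \<open>k\<close> has its vectors \<open>w x\<close> in an open
  half-space. The family \<open>w\<close> is odd, and topology forbids this for a suitable set of few vertices in
  a face of low dimension.

  The faces of dimension at most \<open>d\<close> of the boundary of the cube contain a sphere of dimension \<open>d\<close>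
  invariant under the antipodal map, made of faces with alternating signs. In its barycentric
  subdivision every simplex is a flag of \<open>d + 1\<close> faces, and choosing antipodally a vertex in each face
  turns \<open>w\<close> into an odd map on the vertices of the subdivision. By a Borsuk--Ulam argument
  (\<open>ex_flag_not_in_open_halfspace\<close>) there is a flag whose vectors do not lie in an open half-space.
  Its \<open>d + 1\<close> vertices lie in one face of dimension \<open>d\<close>. But any \<open>d + 1\<close> vertices of a \<open>d\<close>-dimensional
  cube lie in a ball of radius \<open>d / 2 + O(sqrt (d * ln d))\<close> around some vertex
  (\<open>ex_balanced_centre\<close>, a derandomised Chernoff bound). Hence this radius exceeds \<open>k\<close>, which forces
  \<open>d \<ge> 2 * k - O(sqrt (k * ln k))\<close>.

  The Borsuk--Ulam argument is combinatorial. For vectors in general position, the indicator modulo 2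
  of ``the vectors surround the origin of \<open>\<real>\<^sup>m\<^sup>+\<^sup>1\<close>'' is the coboundary of the indicator of ``their
  cone meets the negative half of the last axis'' (\<open>surrounds_0_eq_sum_facets\<close>), while modulo 2 the
  boundary of a hemisphere of the sphere above is a hemisphere of one dimension less plus its antipode
  (\<open>sum_boundary_alternating\<close>). By oddness the number of surrounding flags in a hemisphere
  has the same parity in all dimensions, and in dimension 0 it is 1
  (\<open>odd_number_of_surrounding_flags\<close>). A small perturbation gives general position.
\<close>

section \<open>Arithmetic modulo 2\<close>

text \<open>Rewriting addition of bits to exclusive or breaks up sums, which below are handled as in any
  abelian group.\<close>

declare add_bit_eq_xor [simp del]

lemma bit_add_self [simp]: "x + x = (0 :: bit)"
  by (cases x) simp_all

lemma bit_add_left_self [simp]: "x + (x + y) = (y :: bit)"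
  by (simp add: add.assoc[symmetric])

section \<open>Signed dependences of finitely many vectors\<close>

lemma underdetermined_system_solvable:
  fixes M :: "'b \<Rightarrow> 'a \<Rightarrow> real"
  assumes "finite B" "finite A" "card B < card A"
  shows "\<exists>c. (\<exists>x\<in>A. c x \<noteq> 0) \<and> (\<forall>b\<in>B. (\<Sum>x\<in>A. c x * M b x) = 0)"
  using assms
proof (induction B arbitrary: A M rule: finite_induct)
  case empty
  then have "A \<noteq> {}" by auto
  then show ?case by (intro exI[of _ "\<lambda>_. 1"]) auto
next
  case (insert q B)
  show ?case
  proof (cases "\<forall>x\<in>A. M q x = 0")
    case True
    from insert.IH[of A M] insert.prems insert.hyps obtain c where
      "\<exists>x\<in>A. c x \<noteq> 0" "\<forall>b\<in>B. (\<Sum>x\<in>A. c x * M b x) = 0" by auto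
    with True show ?thesis by (intro exI[of _ c]) (simp add: sum.neutral)
  next
    case False
    then obtain p where p: "p \<in> A" "M q p \<noteq> 0" by auto
    define A' where "A' = A - {p}"
    have A': "finite A'" "p \<notin> A'" "A = insert p A'"
      using insert.prems p by (auto simp: A'_def)
    define M' where "M' b x = M b x - M q x / M q p * M b p" for b x
    have "card B < card A'" using insert.prems insert.hyps A' by simp
    from insert.IH[OF A'(1) this, of M'] obtain c where
      c: "\<exists>x\<in>A'. c x \<noteq> 0" "\<forall>b\<in>B. (\<Sum>x\<in>A'. c x * M' b x) = 0" by auto
    define c' where "c' = c(p := - (\<Sum>x\<in>A'. c x * M q x) / M q p)"
    have sum_eq: "(\<Sum>x\<in>A. c' x * M b x) = (\<Sum>x\<in>A'. c x * M' b x)" for b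
    proof -
      have "(\<Sum>x\<in>A'. c' x * M b x) = (\<Sum>x\<in>A'. c x * M b x)"
        using A' by (intro sum.cong) (auto simp: c'_def)
      then have "(\<Sum>x\<in>A. c' x * M b x)
          = - (\<Sum>x\<in>A'. c x * M q x) / M q p * M b p + (\<Sum>x\<in>A'. c x * M b x)"
        using A' by (simp add: c'_def)
      also have "\<dots> = (\<Sum>x\<in>A'. c x * M' b x)"
        by (simp add: M'_def right_diff_distrib sum_subtractf sum_divide_distrib sum_distrib_right
            mult.assoc)
      finally show ?thesis .
    qed
    have "M' q x = 0" for x using p by (simp add: M'_def)
    then have "\<forall>b\<in>insert q B. (\<Sum>x\<in>A. c' x * M b x) = 0"
      using c(2) by (simp add: sum_eq)
    moreover have "\<exists>x\<in>A. c' x \<noteq> 0" using c(1) A' by (auto simp: c'_def)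
    ultimately show ?thesis by blast
  qed
qed

definition lincomb :: "('a \<Rightarrow> nat \<Rightarrow> real) \<Rightarrow> 'a set \<Rightarrow> ('a \<Rightarrow> real) \<Rightarrow> nat \<Rightarrow> real" where
  "lincomb w A c i = (\<Sum>x\<in>A. c x * w x i)"

definition indep :: "('a \<Rightarrow> nat \<Rightarrow> real) \<Rightarrow> nat \<Rightarrow> 'a set \<Rightarrow> bool" where
  "indep w j A \<longleftrightarrow> (\<forall>c. (\<forall>i<j. lincomb w A c i = 0) \<longrightarrow> (\<forall>x\<in>A. c x = 0))"

text \<open>The vectors are truncated to their first \<open>j\<close> coordinates, so that one family \<open>w\<close> serves for all
  dimensions \<open>j\<close> at once. For finite \<open>A\<close>, the origin of \<open>\<real>\<^sup>j\<close> lies in the convex hull of \<open>A\<close>.\<close>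

definition surrounds_0 :: "('a \<Rightarrow> nat \<Rightarrow> real) \<Rightarrow> nat \<Rightarrow> 'a set \<Rightarrow> bool" where
  "surrounds_0 w j A \<longleftrightarrow>
     (\<exists>c. (\<forall>x\<in>A. c x \<ge> 0) \<and> (\<exists>x\<in>A. c x > 0) \<and> (\<forall>i<j. lincomb w A c i = 0))"

text \<open>The cone over \<open>A\<close> in \<open>\<real>\<^sup>j\<^sup>+\<^sup>1\<close> contains a vector on the last coordinate axis, on the side given by the
  sign of \<open>e\<close>.\<close>

definition meets_ray :: "real \<Rightarrow> ('a \<Rightarrow> nat \<Rightarrow> real) \<Rightarrow> nat \<Rightarrow> 'a set \<Rightarrow> bool" where
  "meets_ray e w j A \<longleftrightarrow>
     (\<exists>c. (\<forall>x\<in>A. c x \<ge> 0) \<and> (\<forall>i<j. lincomb w A c i = 0) \<and> e * lincomb w A c j > 0)"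

lemma lincomb_linear:
  "lincomb w A (\<lambda>x. r * c x + s * c' x) i = r * lincomb w A c i + s * lincomb w A c' i"
  by (simp add: lincomb_def sum.distrib sum_distrib_left algebra_simps)

lemma lincomb_cong: "(\<And>x. x \<in> A \<Longrightarrow> c x = c' x) \<Longrightarrow> lincomb w A c i = lincomb w A c' i"
  unfolding lincomb_def by (auto intro: sum.cong)

lemma lincomb_vanishing:
  assumes "finite A" "B \<subseteq> A" "\<And>x. x \<in> A - B \<Longrightarrow> c x = 0"
  shows "lincomb w A c i = lincomb w B c i"
  unfolding lincomb_def by (rule sum.mono_neutral_right) (use assms in auto)

lemma indepD: "indep w j A \<Longrightarrow> (\<And>i. i < j \<Longrightarrow> lincomb w A c i = 0) \<Longrightarrow> x \<in> A \<Longrightarrow> c x = 0"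
  unfolding indep_def by blast

definition in_general_position :: "('a \<Rightarrow> nat \<Rightarrow> real) \<Rightarrow> nat \<Rightarrow> 'a set \<Rightarrow> bool" where
  "in_general_position w d A \<longleftrightarrow> (\<forall>j\<le>d. \<forall>B\<subseteq>A. finite B \<longrightarrow> card B \<le> j \<longrightarrow> indep w j B)"

lemma in_general_position_subset:
  "in_general_position w d A \<Longrightarrow> B \<subseteq> A \<Longrightarrow> in_general_position w d B"
  unfolding in_general_position_def by blast

text \<open>The form in which general position is used: a linear dependence that vanishes on all but at most
  \<open>j\<close> vectors of \<open>\<real>\<^sup>j\<close> is trivial.\<close>

lemma general_position_vanishing:
  assumes gp: "in_general_position w d A" and "finite A" "j \<le> d"
    and c: "\<And>i. i < j \<Longrightarrow> lincomb w A c i = 0"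
    and Z: "Z \<subseteq> A" "\<And>x. x \<in> Z \<Longrightarrow> c x = 0" "card A \<le> j + card Z"
    and "x \<in> A"
  shows "c x = 0"
proof (cases "x \<in> Z")
  case False
  have fin: "finite (A - Z)" "finite Z" using assms(2) Z(1) finite_subset by auto
  have "card (A - Z) = card A - card Z" using Z(1) fin by (simp add: card_Diff_subset)
  then have "indep w j (A - Z)" using gp assms(3) Z(3) fin unfolding in_general_position_def by auto
  moreover have "lincomb w (A - Z) c i = 0" if "i < j" for i
    using c[OF that] lincomb_vanishing[of A "A - Z" c w i] assms(2) Z by auto
  ultimately show ?thesis using indepD[of w j "A - Z" c x] False \<open>x \<in> A\<close> by blast
qed (use Z in auto)

text \<open>In general position, \<open>m + 1\<close> vectors in \<open>\<real>\<^sup>m\<close> have, up to scaling, a single linear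
  dependence. If it is nonnegative, the same combination taken in \<open>\<real>\<^sup>m\<^sup>+\<^sup>1\<close> is a nonzero point of the last axis, so it lies on exactly one of
  the two sides.\<close>

lemma surrounds_0_eq_meets_rays:
  assumes gp: "in_general_position w d A" and fin: "finite A" and card: "card A = Suc m" and "m < d"
  shows "(of_bool (surrounds_0 w m A) :: bit)
           = of_bool (meets_ray 1 w m A) + of_bool (meets_ray (-1) w m A)"
proof -
  have nz: "lincomb w A c m \<noteq> 0"
    if "\<And>i. i < m \<Longrightarrow> lincomb w A c i = 0" "x \<in> A" "c x \<noteq> 0" for c x
  proof
    assume "lincomb w A c m = 0"
    then have "lincomb w A c i = 0" if "i < Suc m" for i
      using that \<open>\<And>i. i < m \<Longrightarrow> lincomb w A c i = 0\<close> by (cases "i = m") auto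
    from general_position_vanishing[where Z="{}" and c=c, OF gp fin _ this] that card \<open>m < d\<close>
    show False by (metis Suc_leI card.empty empty_iff empty_subsetI add_0_right order_refl)
  qed
  have ex: "\<exists>x\<in>A. c x > 0" if "\<forall>x\<in>A. c x \<ge> 0" "lincomb w A c m \<noteq> 0" for c
  proof (rule ccontr)
    assume "\<not> ?thesis"
    then have "\<forall>x\<in>A. c x = 0" using that by force
    then show False using that by (simp add: lincomb_def)
  qed
  have "\<not> (meets_ray 1 w m A \<and> meets_ray (-1) w m A)"
  proof
    assume "meets_ray 1 w m A \<and> meets_ray (-1) w m A"
    then obtain c c' where c: "\<forall>x\<in>A. c x \<ge> 0" "\<forall>i<m. lincomb w A c i = 0" "lincomb w A c m > 0"
      and c': "\<forall>x\<in>A. c' x \<ge> 0" "\<forall>i<m. lincomb w A c' i = 0" "lincomb w A c' m < 0"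
      unfolding meets_ray_def by auto
    obtain x where x: "x \<in> A" "c x > 0" using ex[of c] c by auto
    define r where "r = c' x / c x"
    have "r \<ge> 0" using x c' by (simp add: r_def)
    \<comment> \<open>The witnesses are proportional with a ratio \<open>r \<ge> 0\<close>, since \<open>z\<close> vanishes at \<open>x\<close>.\<close>
    define z where "z = (\<lambda>y. 1 * c' y + (- r) * c y)"
    have z: "lincomb w A z i = lincomb w A c' i - r * lincomb w A c i" for i
      unfolding z_def lincomb_linear by simp
    have "z x = 0" using x by (simp add: z_def r_def)
    then have "z y = 0" if "y \<in> A" for y
      by (intro general_position_vanishing[OF gp fin _ _ _ _ _ that, of m z "{x}"])
        (use x c c' card \<open>m < d\<close> in \<open>auto simp: z\<close>)
    then have "lincomb w A z m = 0" by (simp add: lincomb_def)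
    then have "lincomb w A c' m = r * lincomb w A c m" by (simp add: z)
    moreover have "r * lincomb w A c m \<ge> 0" using \<open>r \<ge> 0\<close> c by simp
    ultimately show False using c' by simp
  qed
  moreover have "surrounds_0 w m A \<longleftrightarrow> meets_ray 1 w m A \<or> meets_ray (-1) w m A"
  proof
    assume "surrounds_0 w m A"
    then obtain c where c: "\<forall>x\<in>A. c x \<ge> 0" "\<exists>x\<in>A. c x > 0" "\<forall>i<m. lincomb w A c i = 0"
      unfolding surrounds_0_def by auto
    then have "lincomb w A c m \<noteq> 0" using nz by force
    then have "lincomb w A c m > 0 \<or> lincomb w A c m < 0" by linarith
    with c show "meets_ray 1 w m A \<or> meets_ray (-1) w m A" unfolding meets_ray_def by auto
  next
    assume "meets_ray 1 w m A \<or> meets_ray (-1) w m A"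
    then obtain c where "\<forall>x\<in>A. c x \<ge> 0" "\<forall>i<m. lincomb w A c i = 0" "lincomb w A c m \<noteq> 0"
      unfolding meets_ray_def by fastforce
    with ex show "surrounds_0 w m A" unfolding surrounds_0_def by blast
  qed
  ultimately show ?thesis by auto
qed


text \<open>This is the cocycle identity that drives the parity argument: surrounding the origin of
  \<open>\<real>\<^sup>m\<^sup>+\<^sup>1\<close> is the mod 2 coboundary of meeting the negative half of the last axis.

  The dependences of the \<open>m + 2\<close> vectors in the first \<open>m\<close> coordinates form a plane, in which the
  nonnegative ones form a cone. If this cone is \<open>0\<close>, both sides vanish. Otherwise it has two
  extreme rays, and by general position each of them vanishes at exactly one vector; these are \<open>g a\<close>
  and \<open>- g b\<close> in the proof. The right-hand side counts the
  extreme rays on which the last coordinate is negative, and the origin is surrounded iff it changes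
  sign between the two rays, hence iff that count is 1.\<close>

lemma surrounds_0_eq_sum_facets:
  assumes gp: "in_general_position w d A" and fin: "finite A" and card: "card A = Suc (Suc m)"
    and "m < d"
  shows "(of_bool (surrounds_0 w (Suc m) A) :: bit)
           = (\<Sum>x\<in>A. of_bool (meets_ray (-1) w m (A - {x})))"
proof (cases "\<exists>c. (\<forall>x\<in>A. c x \<ge> 0) \<and> (\<exists>x\<in>A. c x > 0) \<and> (\<forall>i<m. lincomb w A c i = 0)")
  case False
  have "\<not> meets_ray (-1) w m (A - {x})" if "x \<in> A" for x
  proof
    assume "meets_ray (-1) w m (A - {x})"
    then obtain c where c: "\<forall>y\<in>A - {x}. c y \<ge> 0" "\<forall>i<m. lincomb w (A - {x}) c i = 0"
      "lincomb w (A - {x}) c m < 0" unfolding meets_ray_def by auto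
    define c' where "c' = c(x := 0)"
    have eq: "lincomb w A c' i = lincomb w (A - {x}) c i" for i
      using lincomb_vanishing[of A "A - {x}" c' w i] lincomb_cong[of "A - {x}" c' c w i] fin
      by (auto simp: c'_def)
    have "\<exists>y\<in>A. c' y > 0"
    proof (rule ccontr)
      assume "\<not> ?thesis"
      then have "\<forall>y\<in>A. c' y = 0" using c by (force simp: c'_def)
      then have "lincomb w A c' m = 0" by (simp add: lincomb_def)
      then show False using c eq by simp
    qed
    moreover have "\<forall>y\<in>A. c' y \<ge> 0" using c by (auto simp: c'_def)
    ultimately show False using False c eq by metis
  qed
  moreover have "\<not> surrounds_0 w (Suc m) A"
    using False unfolding surrounds_0_def by (meson less_SucI)
  ultimately show ?thesis by simp
next
  case True
  then obtain c0 where c0: "\<forall>x\<in>A. c0 x \<ge> 0" "\<exists>x\<in>A. c0 x > 0" "\<And>i. i < m \<Longrightarrow> lincomb w A c0 i = 0"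
    by auto
  have two_zeros: "c z = 0"
    if "\<And>i. i < m \<Longrightarrow> lincomb w A c i = 0" "x \<in> A" "y \<in> A" "x \<noteq> y" "c x = 0" "c y = 0" "z \<in> A"
    for c x y z
    by (rule general_position_vanishing[OF gp fin, of m c "{x, y}"])
      (use that card \<open>m < d\<close> in auto)
  have one_zero: "c z = 0"
    if "\<And>i. i < m \<Longrightarrow> lincomb w A c i = 0" "lincomb w A c m = 0" "x \<in> A" "c x = 0" "z \<in> A" for c x z
    by (rule general_position_vanishing[OF gp fin, of "Suc m" c "{x}"])
      (use that card \<open>m < d\<close> in \<open>auto simp: less_Suc_eq\<close>)
  have through: "\<exists>c. (\<forall>i<m. lincomb w A c i = 0) \<and> c x = 0 \<and> (\<forall>z\<in>A - {x}. c z \<noteq> 0)" if "x \<in> A" for x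
  proof -
    have "card {..<m} < card (A - {x})" using that fin card by simp
    from underdetermined_system_solvable[OF _ _ this, of "\<lambda>i x. w x i"] fin
    obtain c where c: "\<exists>y\<in>A - {x}. c y \<noteq> 0" "\<forall>i<m. lincomb w (A - {x}) c i = 0"
      unfolding lincomb_def by auto
    define c' where "c' = c(x := 0)"
    have eq: "lincomb w A c' i = lincomb w (A - {x}) c i" for i
      using lincomb_vanishing[of A "A - {x}" c' w i] lincomb_cong[of "A - {x}" c' c w i] fin
      by (auto simp: c'_def)
    have "c' z \<noteq> 0" if z: "z \<in> A - {x}" for z
    proof
      assume "c' z = 0"
      then have "c' y = 0" if "y \<in> A" for y
        using two_zeros[of c' x z y] that z \<open>x \<in> A\<close> c eq by (auto simp: c'_def)
      then show False using c(1) by (metis DiffD1 DiffD2 c'_def fun_upd_apply singletonI)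
    qed
    then show ?thesis using c eq by (intro exI[of _ c']) (auto simp: c'_def)
  qed
  \<comment> \<open>A nonnegative dependence with a zero coordinate is moved off the boundary of the orthant.\<close>
  have "\<exists>l. (\<forall>i<m. lincomb w A l i = 0) \<and> (\<forall>x\<in>A. l x > 0)"
  proof (cases "\<forall>x\<in>A. c0 x > 0")
    case False
    then obtain x where x: "x \<in> A" "c0 x = 0" using c0 by force
    obtain y where y: "y \<in> A" "y \<noteq> x" using c0(2) x by force
    have pos: "c0 z > 0" if "z \<in> A" "z \<noteq> x" for z
      using two_zeros[of c0 x z] c0 x that by (metis order_less_le)
    obtain \<mu>' where mu': "\<forall>i<m. lincomb w A \<mu>' i = 0" "\<mu>' x \<noteq> 0" using through[OF y(1)] x y by auto
    define \<mu> where "\<mu> = (\<lambda>z. sgn (\<mu>' x) * \<mu>' z + 0 * \<mu>' z)"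
    have mu: "\<forall>i<m. lincomb w A \<mu> i = 0" unfolding \<mu>_def lincomb_linear using mu' by simp
    have "\<mu> x > 0" using mu' by (simp add: \<mu>_def sgn_mult_self_eq abs_sgn[symmetric] mult.commute)
    have "\<forall>\<^sub>F e in at_right 0. c0 z + e * \<mu> z > 0" if "z \<in> A" for z
    proof (cases "z = x")
      case True
      have "\<forall>\<^sub>F e in at_right (0 :: real). e > 0" by (rule eventually_at_right_less)
      then show ?thesis
        by eventually_elim (use x \<open>\<mu> x > 0\<close> True in auto)
    next
      case False
      have "((\<lambda>e. c0 z + e * \<mu> z) \<longlongrightarrow> c0 z + 0 * \<mu> z) (at_right 0)" by (intro tendsto_intros)
      then show ?thesis using pos[OF that False] by (auto intro: order_tendstoD)
    qed
    then have "\<forall>\<^sub>F e in at_right 0. \<forall>z\<in>A. c0 z + e * \<mu> z > 0"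
      using fin by (simp add: eventually_ball_finite)
    then obtain e where e: "\<forall>z\<in>A. c0 z + e * \<mu> z > 0"
      using eventually_happens' trivial_limit_at_right_real by blast
    have "lincomb w A (\<lambda>z. 1 * c0 z + e * \<mu> z) i = 0" if "i < m" for i
      unfolding lincomb_linear using that c0 mu by simp
    with e show ?thesis by auto
  qed (use c0 in auto)
  then obtain l where l: "\<forall>i<m. lincomb w A l i = 0" "\<And>x. x \<in> A \<Longrightarrow> l x > 0" by auto
  obtain x0 where "x0 \<in> A" using c0(2) by auto
  then obtain \<mu> where mu: "\<forall>i<m. lincomb w A \<mu> i = 0" "\<forall>z\<in>A - {x0}. \<mu> z \<noteq> 0" "\<mu> x0 = 0"
    using through by metis
  \<comment> \<open>\<open>\<mu>\<close> and the positive \<open>l\<close> span the plane, and \<open>g x\<close> is an element of it vanishing at \<open>x\<close>.\<close>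
  \<comment> \<open>Its sign at \<open>z\<close> is that of \<open>\<rho> z - \<rho> x\<close>: extreme rays sit at the minimum and the maximum of \<open>\<rho>\<close>.\<close>
  define \<rho> where "\<rho> x = \<mu> x / l x" for x
  define g where "g x = (\<lambda>z. 1 * \<mu> z + (- \<rho> x) * l z)" for x
  have g0: "lincomb w A (g x) i = 0" if "i < m" for i x
    unfolding g_def lincomb_linear using that l mu by simp
  have g_zero: "g x z = l z * (\<rho> z - \<rho> x)" if "z \<in> A" for x z
    using l(2)[OF that] by (simp add: g_def \<rho>_def field_simps)
  have inj: "inj_on \<rho> A"
  proof (rule inj_onI, rule ccontr)
    fix x y assume xy: "x \<in> A" "y \<in> A" "\<rho> x = \<rho> y" "x \<noteq> y"
    have z: "g x z = 0" if "z \<in> A" for z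
      using two_zeros[of "g x" x y z] that xy g0 g_zero by auto
    have eq: "\<rho> z = \<rho> x" if "z \<in> A" for z using z[OF that] g_zero[OF that] l(2)[OF that] by simp
    obtain z where "z \<in> A" "z \<noteq> x0" using xy by metis
    then have "\<rho> z \<noteq> 0" using mu l(2) by (force simp: \<rho>_def)
    moreover have "\<rho> x0 = 0" using mu by (simp add: \<rho>_def)
    ultimately show False using eq \<open>z \<in> A\<close> \<open>x0 \<in> A\<close> by metis
  qed
  obtain a where a: "a \<in> A" "\<And>z. z \<in> A \<Longrightarrow> \<rho> a \<le> \<rho> z"
    using fin \<open>x0 \<in> A\<close> by (metis arg_min_if_finite(1) arg_min_least empty_iff)
  obtain b where b: "b \<in> A" "\<And>z. z \<in> A \<Longrightarrow> \<rho> z \<le> \<rho> b"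
    using fin \<open>x0 \<in> A\<close> arg_min_if_finite(1)[of A "\<lambda>z. - \<rho> z"] arg_min_least[of A _ "\<lambda>z. - \<rho> z"]
    by (metis empty_iff neg_le_iff_le)
  have ab: "\<rho> a < \<rho> b"
  proof -
    obtain y where "y \<in> A" "y \<noteq> a"
      using card fin a(1) by (metis card_Suc_eq insert_iff)
    then have "\<rho> y \<noteq> \<rho> a" using inj a(1) by (metis inj_onD)
    then show ?thesis using a(2)[OF \<open>y \<in> A\<close>] b(2)[OF \<open>y \<in> A\<close>] by linarith
  qed
  then have "a \<noteq> b" by auto
  define h where "h x = lincomb w A (g x) m" for x
  have h_nz: "h x \<noteq> 0" if "x \<in> A" for x
  proof
    assume "h x = 0"
    then have "g x z = 0" if "z \<in> A" for z
      using one_zero[of "g x" x z] that \<open>x \<in> A\<close> g0 g_zero h_def by auto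
    then have "\<rho> z = \<rho> x" if "z \<in> A" for z using g_zero[OF that] l(2)[OF that] that by force
    then show False using ab a(1) b(1) by force
  qed
  have ga: "g a z \<ge> 0" if "z \<in> A" for z using g_zero[OF that] a(2)[OF that] l(2)[OF that] by simp
  have gb: "g b z \<le> 0" if "z \<in> A" for z
    using g_zero[OF that] b(2)[OF that] l(2)[OF that] by (simp add: mult_le_0_iff)
  have gab: "g a b > 0" "g b a < 0" "g a a = 0" "g b b = 0"
    using ab l(2) a(1) b(1) by (auto simp: g_zero mult_less_0_iff)
  have reach: "meets_ray (-1) w m (A - {x}) \<longleftrightarrow> x = a \<and> h a < 0 \<or> x = b \<and> h b > 0" if x: "x \<in> A" for x
  proof
    assume "meets_ray (-1) w m (A - {x})"
    then obtain c where c: "\<forall>y\<in>A - {x}. c y \<ge> 0" "\<forall>i<m. lincomb w (A - {x}) c i = 0"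
      "lincomb w (A - {x}) c m < 0" unfolding meets_ray_def by auto
    define c' where "c' = c(x := 0)"
    have eq: "lincomb w A c' i = lincomb w (A - {x}) c i" for i
      using lincomb_vanishing[of A "A - {x}" c' w i] lincomb_cong[of "A - {x}" c' c w i] fin
      by (auto simp: c'_def)
    have c'_nn: "c' z \<ge> 0" if "z \<in> A" for z using c that by (auto simp: c'_def)
    obtain z where z: "z \<in> A" "z \<noteq> x" using a(1) b(1) \<open>a \<noteq> b\<close> by metis
    have gz: "g x z \<noteq> 0" using z x inj g_zero l(2) by (force simp: inj_on_def)
    define t where "t = c' z / g x z"
    define r where "r = (\<lambda>y. 1 * c' y + (- t) * g x y)"
    have r_lincomb: "lincomb w A r i = lincomb w A c' i - t * lincomb w A (g x) i" for i
      unfolding r_def lincomb_linear by simp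
    have "lincomb w A r i = 0" if "i < m" for i using that c(2) eq g0 by (simp add: r_lincomb)
    moreover have "r x = 0" using g_zero[OF x, of x] by (simp add: r_def c'_def)
    moreover have "r z = 0" using gz by (simp add: r_def t_def)
    ultimately have r0: "r y = 0" if "y \<in> A" for y
      using two_zeros[OF _ x z(1) z(2)[symmetric] _ _ that] by blast
    then have c'_eq: "c' y = t * g x y" if "y \<in> A" for y using r0[OF that] by (simp add: r_def)
    have "lincomb w A r m = 0" using r0 by (simp add: lincomb_def)
    then have neg: "t * h x < 0" using r_lincomb[of m] c(3) eq[of m] by (simp add: h_def)
    show "x = a \<and> h a < 0 \<or> x = b \<and> h b > 0"
    proof (cases "t > 0")
      case True
      then have "g x a \<ge> 0" using c'_nn[OF a(1)] c'_eq[OF a(1)] by (simp add: zero_le_mult_iff)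
      then have "\<rho> x \<le> \<rho> a" using g_zero[OF a(1)] l(2)[OF a(1)] by (simp add: zero_le_mult_iff)
      then have "x = a" using a x inj by (metis inj_onD order_antisym)
      then show ?thesis using neg True by (simp add: mult_less_0_iff)
    next
      case False
      then have "t < 0" using neg by (cases "t = 0") auto
      then have "g x b \<le> 0" using c'_nn[OF b(1)] c'_eq[OF b(1)] by (simp add: zero_le_mult_iff)
      then have "\<rho> b \<le> \<rho> x" using g_zero[OF b(1)] l(2)[OF b(1)] by (simp add: mult_le_0_iff)
      then have "x = b" using b x inj by (metis inj_onD order_antisym)
      then show ?thesis using neg \<open>t < 0\<close> by (simp add: mult_less_0_iff)
    qed
  next
    assume "x = a \<and> h a < 0 \<or> x = b \<and> h b > 0"
    then obtain s where s: "\<And>z. z \<in> A \<Longrightarrow> s * g x z \<ge> 0" "s * h x < 0"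
    proof (elim disjE conjE)
      assume "x = a" "h a < 0" then show thesis using ga by (intro that[of 1]) auto
    next
      assume "x = b" "h b > 0" then show thesis using gb by (intro that[of "-1"]) auto
    qed
    define c where "c = (\<lambda>z. s * g x z + 0 * g x z)"
    have c: "lincomb w (A - {x}) c i = s * lincomb w A (g x) i" for i
      using lincomb_vanishing[of A "A - {x}" c w i] fin g_zero x
      unfolding c_def lincomb_linear by auto
    show "meets_ray (-1) w m (A - {x})"
      unfolding meets_ray_def by (rule exI[of _ c]) (use s c g0 in \<open>auto simp: c_def h_def\<close>)
  qed
  have "surrounds_0 w (Suc m) A \<longleftrightarrow> (h a < 0 \<longleftrightarrow> h b < 0)"
  proof
    assume "surrounds_0 w (Suc m) A"
    then obtain c where c: "\<forall>x\<in>A. c x \<ge> 0" "\<exists>x\<in>A. c x > 0" "\<forall>i<Suc m. lincomb w A c i = 0"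
      unfolding surrounds_0_def by auto
    have pos: "c x > 0" if "x \<in> A" for x
      using one_zero[of c x] c that by (metis less_Suc_eq order_less_le)
    \<comment> \<open>Coordinates of \<open>c\<close> with respect to \<open>g a\<close> and \<open>g b\<close>, read off at \<open>b\<close> and \<open>a\<close>.\<close>
    define \<alpha> where "\<alpha> = c b / g a b"
    define \<beta> where "\<beta> = c a / g b a"
    have ab_signs: "\<alpha> > 0" "\<beta> < 0"
      using pos a(1) b(1) gab by (auto simp: \<alpha>_def \<beta>_def divide_less_0_iff)
    define r' where "r' = (\<lambda>y. \<alpha> * g a y + \<beta> * g b y)"
    define r where "r = (\<lambda>y. 1 * c y + (- 1) * r' y)"
    have r_lincomb: "lincomb w A r i = lincomb w A c i - (\<alpha> * lincomb w A (g a) i + \<beta> * lincomb w A (g b) i)" for i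
      unfolding r_def lincomb_linear r'_def by simp
    have "lincomb w A r i = 0" if "i < m" for i using that c(3) g0 by (simp add: r_lincomb)
    moreover have "r a = 0" "r b = 0"
      using gab by (simp_all add: r_def r'_def \<alpha>_def \<beta>_def)
    ultimately have "r z = 0" if "z \<in> A" for z
      using two_zeros[OF _ a(1) b(1) \<open>a \<noteq> b\<close> _ _ that] by blast
    then have "lincomb w A r m = 0" by (simp add: lincomb_def)
    then have "\<alpha> * h a + \<beta> * h b = 0" using c(3) r_lincomb[of m] by (simp add: h_def)
    then show "h a < 0 \<longleftrightarrow> h b < 0"
      using ab_signs h_nz[OF a(1)] h_nz[OF b(1)]
      by (smt (verit) mult_neg_neg mult_pos_neg mult_pos_pos mult_neg_pos)
  next
    assume same: "h a < 0 \<longleftrightarrow> h b < 0"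
    define c where "c = (\<lambda>z. \<bar>h b\<bar> * g a z + (- \<bar>h a\<bar>) * g b z)"
    have "c z \<ge> 0" if "z \<in> A" for z
      using mult_nonneg_nonneg[OF abs_ge_zero ga[OF that], of "h b"]
        mult_nonneg_nonpos[OF abs_ge_zero gb[OF that], of "h a"]
      by (simp add: c_def)
    moreover have "c a > 0"
      using gab h_nz[OF a(1)] by (simp add: c_def mult_pos_neg)
    moreover have "lincomb w A c i = 0" if "i < Suc m" for i
    proof (cases "i = m")
      case True
      have "lincomb w A c m = \<bar>h b\<bar> * h a - \<bar>h a\<bar> * h b"
        unfolding c_def lincomb_linear h_def by simp
      also have "\<dots> = 0" using same h_nz[OF a(1)] h_nz[OF b(1)] by (auto simp: abs_if)
      finally show ?thesis using True by simp
    next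
      case False
      then show ?thesis unfolding c_def lincomb_linear using g0 that by simp
    qed
    ultimately show "surrounds_0 w (Suc m) A" unfolding surrounds_0_def using a(1) by blast
  qed
  moreover have "(\<Sum>x\<in>A. of_bool (meets_ray (-1) w m (A - {x}))) = (of_bool (h a < 0) + of_bool (h b > 0) :: bit)"
  proof -
    have "(\<Sum>x\<in>A. of_bool (meets_ray (-1) w m (A - {x})))
      = (\<Sum>x\<in>A. (if x = a then of_bool (h a < 0) else 0) + (if x = b then of_bool (h b > 0) else 0 :: bit))"
      using reach \<open>a \<noteq> b\<close> by (intro sum.cong) auto
    then show ?thesis using fin a(1) b(1) by (simp add: sum.distrib)
  qed
  ultimately show ?thesis using h_nz[OF a(1)] h_nz[OF b(1)] by auto
qed

section \<open>Flags of faces of the cube\<close>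

text \<open>A face of the cube \<open>[-1, 1]\<^sup>n\<close> is encoded by a sign vector whose zeros (stars) are the free
  coordinates. A flag runs from a face down through faces with one star fewer at each step, i.e. it is
  a simplex of the barycentric subdivision of the face.\<close>

definition stars :: "nat \<Rightarrow> (nat \<Rightarrow> int) \<Rightarrow> nat set" where
  "stars n s = {i. i < n \<and> s i = 0}"

fun flags :: "nat \<Rightarrow> nat \<Rightarrow> (nat \<Rightarrow> int) \<Rightarrow> (nat \<Rightarrow> int) list set" where
  "flags n 0 s = {[s]}"
| "flags n (Suc j) s = (\<Union>i\<in>stars n s. \<Union>b\<in>{1, -1}. (#) s ` flags n j (s(i := b)))"

fun flag_sum :: "nat \<Rightarrow> nat \<Rightarrow> ((nat \<Rightarrow> int) list \<Rightarrow> bit) \<Rightarrow> (nat \<Rightarrow> int) \<Rightarrow> bit" where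
  "flag_sum n 0 f s = f [s]"
| "flag_sum n (Suc j) f s = (\<Sum>i\<in>stars n s. \<Sum>b\<in>{1, -1}. flag_sum n j (\<lambda>l. f (s # l)) (s(i := b)))"

fun coboundary :: "('a list \<Rightarrow> bit) \<Rightarrow> 'a list \<Rightarrow> bit" where
  "coboundary g [] = 0"
| "coboundary g (s # l) = g l + coboundary (\<lambda>l'. g (s # l')) l"

lemma sum_signs: "(\<Sum>b\<in>{1, -1 :: int}. f b) = f 1 + f (-1)"
  by simp

lemma finite_stars [simp]: "finite (stars n s)"
  by (simp add: stars_def)

lemma finite_flags: "finite (flags n j s)"
  by (induction n j s rule: flags.induct) (auto simp del: fun_upd_apply)

lemma stars_upd: "b \<noteq> 0 \<Longrightarrow> stars n (s(i := b)) = stars n s - {i}"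
  by (auto simp: stars_def)

lemma stars_uminus [simp]: "stars n (\<lambda>i. - s i) = stars n s"
  by (auto simp: stars_def)

lemma flag_sum_cong:
  assumes "\<And>l. l \<in> flags n j s \<Longrightarrow> f l = g l"
  shows "flag_sum n j f s = flag_sum n j g s"
  using assms
proof (induction j arbitrary: f g s)
  case (Suc j)
  show ?case unfolding flag_sum.simps
  proof (intro sum.cong refl)
    fix i and b :: int
    assume "i \<in> stars n s" "b \<in> {1, - 1}"
    then show "flag_sum n j (\<lambda>l. f (s # l)) (s(i := b)) = flag_sum n j (\<lambda>l. g (s # l)) (s(i := b))"
      by (intro Suc.IH Suc.prems) (auto simp del: fun_upd_apply)
  qed
qed simp

lemma flag_sum_zero [simp]: "flag_sum n j (\<lambda>_. 0) s = 0"
  by (induction j arbitrary: s) simp_all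

lemma flag_sum_nonzeroE:
  assumes "flag_sum n j f s \<noteq> 0"
  obtains l where "l \<in> flags n j s" "f l \<noteq> 0"
  using assms flag_sum_cong[of n j s f "\<lambda>_. 0"] by force

lemma flag_sum_add: "flag_sum n j (\<lambda>l. f l + g l) s = flag_sum n j f s + flag_sum n j g s"
  by (induction j arbitrary: f g s) (simp_all add: sum.distrib)

lemma flag_sum_uminus:
  "flag_sum n j f (\<lambda>i. - s i) = flag_sum n j (\<lambda>l. f (map (\<lambda>s i. - s i) l)) s"
proof (induction j arbitrary: f s)
  case (Suc j)
  have upd: "(\<lambda>i. - s i)(k := 1) = (\<lambda>i. - (s(k := -1)) i)"
    "(\<lambda>i. - s i)(k := -1) = (\<lambda>i. - (s(k := 1)) i)" for k
    by auto
  have "flag_sum n (Suc j) f (\<lambda>i. - s i) = (\<Sum>i\<in>stars n s.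
      flag_sum n j (\<lambda>l. f ((\<lambda>i. - s i) # l)) (\<lambda>k. - (s(i := -1)) k)
      + flag_sum n j (\<lambda>l. f ((\<lambda>i. - s i) # l)) (\<lambda>k. - (s(i := 1)) k))"
    unfolding flag_sum.simps stars_uminus sum_signs upd by (simp only: add.commute)
  also have "\<dots> = flag_sum n (Suc j) (\<lambda>l. f (map (\<lambda>s i. - s i) l)) s"
    by (simp only: flag_sum.simps sum_signs Suc.IH list.map add.commute)
  finally show ?case .
qed simp

lemma sum_symmetric_eq_0:
  fixes K :: "'a \<Rightarrow> 'a \<Rightarrow> bit"
  assumes "finite Z" "\<And>x y. K x y = K y x"
  shows "(\<Sum>x\<in>Z. \<Sum>y\<in>Z - {x}. K x y) = 0"
  using assms(1)
proof induction
  case (insert z F)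
  have "(\<Sum>x\<in>F. \<Sum>y\<in>insert z F - {x}. K x y) = (\<Sum>x\<in>F. K x z + (\<Sum>y\<in>F - {x}. K x y))"
    using insert.hyps by (intro sum.cong refl) (subst insert_Diff_if, auto)
  moreover have "insert z F - {z} = F" using insert.hyps by auto
  ultimately show ?case
    using insert by (simp add: sum.distrib assms(2)[of z])
qed simp

text \<open>Stokes' theorem for the barycentric subdivision of a face. Removing an interior or the last member
  of a flag leaves a chain that is completed by exactly two flags, because two stars can be filled in
  either order and the last star by either sign; these terms cancel. Removing the first member leaves
  the flags of the facets.\<close>

lemma flag_sum_coboundary:
  "flag_sum n (Suc j) (coboundary g) s = (\<Sum>i\<in>stars n s. \<Sum>b\<in>{1, -1}. flag_sum n j g (s(i := b)))"
proof (induction j arbitrary: g s)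
  case 0
  show ?case by (simp del: fun_upd_apply)
next
  case (Suc j)
  define H where "H i i' = (\<Sum>b\<in>{1, -1}. \<Sum>b'\<in>{1, -1}.
      flag_sum n j (\<lambda>l. g (s # l)) (s(i := b, i' := b')))" for i i'
  define K where "K i i' = (if i = i' then 0 else H i i')" for i i'
  have K: "K i i' = K i' i" for i i'
    unfolding K_def H_def
    by (subst sum.swap) (auto simp: fun_upd_twist)
  have "flag_sum n (Suc (Suc j)) (coboundary g) s
      = (\<Sum>i\<in>stars n s. \<Sum>b\<in>{1, -1}. flag_sum n (Suc j) g (s(i := b))
          + flag_sum n (Suc j) (coboundary (\<lambda>l. g (s # l))) (s(i := b)))"
    by (subst flag_sum.simps) (simp only: coboundary.simps flag_sum_add)
  also have "\<dots> = (\<Sum>i\<in>stars n s. \<Sum>b\<in>{1, -1}. flag_sum n (Suc j) g (s(i := b)))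
      + (\<Sum>i\<in>stars n s. \<Sum>b\<in>{1, -1}. \<Sum>i'\<in>stars n s - {i}. \<Sum>b'\<in>{1, -1}.
            flag_sum n j (\<lambda>l. g (s # l)) (s(i := b, i' := b')))"
    unfolding Suc.IH sum.distrib by (simp add: stars_upd)
  also have "(\<Sum>i\<in>stars n s. \<Sum>b\<in>{1, -1}. \<Sum>i'\<in>stars n s - {i}. \<Sum>b'\<in>{1, -1}.
            flag_sum n j (\<lambda>l. g (s # l)) (s(i := b, i' := b')))
        = (\<Sum>i\<in>stars n s. \<Sum>i'\<in>stars n s - {i}. K i i')"
    unfolding K_def H_def by (subst sum.swap) (intro sum.cong refl, auto)
  also have "\<dots> = 0" by (rule sum_symmetric_eq_0) (use K in auto)
  finally show ?case by simp
qed

text \<open>The set \<open>P\<close> collects the entries already passed, as needed for the induction.\<close>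

lemma coboundary_set_function:
  assumes "distinct l" "P \<inter> set l = {}"
  shows "coboundary (\<lambda>l. F (P \<union> set l)) l = (\<Sum>x\<in>set l. F (P \<union> set l - {x}))"
  using assms
proof (induction l arbitrary: P)
  case (Cons s l)
  have "coboundary (\<lambda>l. F (insert s P \<union> set l)) l = (\<Sum>x\<in>set l. F (insert s P \<union> set l - {x}))"
    using Cons.prems by (intro Cons.IH) auto
  moreover have "P \<union> set (s # l) - {s} = P \<union> set l" using Cons.prems by auto
  ultimately show ?case using Cons.prems by simp
qed simp

lemma flags_extend:
  assumes "l \<in> flags n j s" "t \<in> set l" "s i \<noteq> 0"
  shows "t i = s i"
  using assms
proof (induction j arbitrary: s l)
  case (Suc j)
  then obtain k b l' where l: "k \<in> stars n s" "l = s # l'" "l' \<in> flags n j (s(k := b))"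
    by auto
  have "i \<noteq> k" using l(1) Suc.prems(3) by (auto simp: stars_def)
  then show ?case using Suc.IH[OF l(3)] Suc.prems(2,3) l(2) by (cases "t = s") simp_all
qed simp

lemma flags_distinct: "l \<in> flags n j s \<Longrightarrow> distinct l"
proof (induction j arbitrary: s l)
  case (Suc j)
  then obtain i b l' where l: "i \<in> stars n s" "b \<in> {1, -1}" "l = s # l'" "l' \<in> flags n j (s(i := b))"
    by auto
  have "s \<notin> set l'"
  proof
    assume "s \<in> set l'"
    from flags_extend[OF l(4) this, of i] l show False by (auto simp: stars_def)
  qed
  then show ?case using l Suc.IH by auto
qed simp

lemma flags_length: "l \<in> flags n j s \<Longrightarrow> length l = Suc j"
  by (induction j arbitrary: s l) auto

definition sign_vectors :: "nat \<Rightarrow> (nat \<Rightarrow> int) set" where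
  "sign_vectors n = {s. (\<forall>i<n. s i \<in> {-1, 0, 1}) \<and> (\<forall>i\<ge>n. s i = 0)}"

lemma flags_sign_vectors: "l \<in> flags n j s \<Longrightarrow> s \<in> sign_vectors n \<Longrightarrow> set l \<subseteq> sign_vectors n"
proof (induction j arbitrary: s l)
  case (Suc j)
  then obtain i b l' where l: "i \<in> stars n s" "b \<in> {1, -1}" "l = s # l'" "l' \<in> flags n j (s(i := b))"
    by auto
  then have "s(i := b) \<in> sign_vectors n" using Suc.prems by (auto simp: sign_vectors_def stars_def)
  then show ?case using Suc l by auto
qed simp

section \<open>The alternating faces\<close>

text \<open>The signs alternate from one block between stars to the next. For \<open>card I = j < n\<close>, these faces and
  their antipodes are the facets of a sphere of dimension \<open>j\<close> inside the boundary of the cube, the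
  boundary of the cyclic zonotope: they are the sign patterns, at \<open>n\<close> points of the line, of real
  polynomials of degree \<open>j\<close> with \<open>j\<close> zeros among these points. Fixing the sign of the first
  block selects a hemisphere.\<close>

definition alternating :: "nat \<Rightarrow> nat set \<Rightarrow> nat \<Rightarrow> int" where
  "alternating n I p = (if n \<le> p \<or> p \<in> I then 0 else (-1) ^ card {i\<in>I. i < p})"

text \<open>An additional sign change before position \<open>t\<close>. As \<open>t\<close> runs from \<open>n\<close> down to \<open>0\<close>, this
  interpolates between the alternating face and its antipode.\<close>

definition alternating_jump :: "nat \<Rightarrow> nat set \<Rightarrow> nat \<Rightarrow> nat \<Rightarrow> int" where
  "alternating_jump n J t p = (if p < t then alternating n J p else - alternating n J p)"

lemma alternating_sign_vector: "alternating n I \<in> sign_vectors n"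
proof -
  have "alternating n I i \<in> {-1, 0, 1}" for i
    unfolding alternating_def by (cases "even (card {k\<in>I. k < i})") auto
  then show ?thesis by (auto simp: sign_vectors_def) (simp add: alternating_def)
qed

lemma stars_alternating: "I \<subseteq> {..<n} \<Longrightarrow> stars n (alternating n I) = I"
  by (auto simp: stars_def alternating_def split: if_splits)

text \<open>Filling the star \<open>i\<close> of an alternating face leaves the alternating face of the other stars, with
  one more sign change just before or just after \<open>i\<close>.\<close>

lemma alternating_insert:
  assumes "i < n" "i \<notin> J" "finite J"
  shows "(\<lambda>b. (alternating n (insert i J))(i := b)) ` {1, -1} = {alternating_jump n J i, alternating_jump n J (Suc i)}"
    and "alternating_jump n J i \<noteq> alternating_jump n J (Suc i)"
proof -
  define e where "e = alternating n J i"
  have e: "e = 1 \<or> e = -1"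
    unfolding e_def alternating_def using assms by (cases "even (card {k\<in>J. k < i})") auto
  have *: "alternating n (insert i J) p = alternating_jump n J i p" if "p \<noteq> i" for p
  proof (cases "i < p")
    case True
    then have "{k \<in> insert i J. k < p} = insert i {k\<in>J. k < p}" by auto
    then show ?thesis using assms that True by (auto simp: alternating_def alternating_jump_def)
  next
    case False
    then have "{k \<in> insert i J. k < p} = {k\<in>J. k < p}" using that by auto
    then show ?thesis using False that by (auto simp: alternating_def alternating_jump_def)
  qed
  have 1: "alternating_jump n J i = (alternating n (insert i J))(i := - e)"
    using * by (auto simp: alternating_jump_def e_def)
  have 2: "alternating_jump n J (Suc i) = (alternating n (insert i J))(i := e)"
    using * by (force simp: alternating_jump_def e_def less_Suc_eq)
  show "(\<lambda>b. (alternating n (insert i J))(i := b)) ` {1, -1} = {alternating_jump n J i, alternating_jump n J (Suc i)}"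
    unfolding 1 2 using e by auto
  show "alternating_jump n J i \<noteq> alternating_jump n J (Suc i)" 
    unfolding 1 2 using e by (metis fun_upd_same one_neq_neg_one add.inverse_inverse)
qed

lemma alternating_jump_star: "i \<in> J \<Longrightarrow> alternating_jump n J i = alternating_jump n J (Suc i)"
  by (auto simp: alternating_jump_def alternating_def fun_eq_iff less_Suc_eq)

lemma alternating_jump_0: "alternating_jump n J 0 = (\<lambda>p. - alternating n J p)"
  by (auto simp: alternating_jump_def)

lemma alternating_jump_n: "alternating_jump n J n = alternating n J"
  by (auto simp: alternating_jump_def alternating_def)

lemma telescope_bit: "(\<Sum>i<n. f i + f (Suc i)) = (f 0 + f n :: bit)"
proof (induction n)
  case (Suc n)
  then show ?case by (simp add: add.assoc)
qed simp

text \<open>The boundary of a hemisphere is the next lower hemisphere together with its antipode. Grouped by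
  the remaining stars \<open>J\<close>, the facets form a telescoping sum over the position of the additional sign
  change; positions in \<open>J\<close> can be included since there the two terms agree.\<close>

lemma sum_boundary_alternating:
  fixes G :: "(nat \<Rightarrow> int) \<Rightarrow> bit"
  shows "(\<Sum>I | I \<subseteq> {..<n} \<and> card I = Suc j. \<Sum>i\<in>stars n (alternating n I). \<Sum>b\<in>{1, -1}. G ((alternating n I)(i := b)))
       = (\<Sum>J | J \<subseteq> {..<n} \<and> card J = j. G (alternating n J) + G (\<lambda>p. - alternating n J p))"
proof -
  define X where "X k = {I. I \<subseteq> {..<n} \<and> card I = k}" for k
  have finX: "finite (X k)" for k unfolding X_def by simp
  have fin: "finite J" if "J \<in> X k" for J k using that finite_subset[of J "{..<n}"] by (simp add: X_def)
  have "(\<Sum>I\<in>X (Suc j). \<Sum>i\<in>stars n (alternating n I). \<Sum>b\<in>{1, -1}. G ((alternating n I)(i := b)))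
      = (\<Sum>I\<in>X (Suc j). \<Sum>i\<in>I. \<Sum>b\<in>{1, -1}. G ((alternating n I)(i := b)))"
    by (rule sum.cong[OF refl], simp only: X_def mem_Collect_eq stars_alternating)
  also have "\<dots> = (\<Sum>(I, i)\<in>Sigma (X (Suc j)) (\<lambda>I. I). \<Sum>b\<in>{1, -1}. G ((alternating n I)(i := b)))"
    by (rule sum.Sigma) (use finX fin in blast)+
  also have "\<dots> = (\<Sum>(J, i)\<in>Sigma (X j) (\<lambda>J. {..<n} - J). \<Sum>b\<in>{1, -1}. G ((alternating n (insert i J))(i := b)))"
  proof (rule sum.reindex_bij_witness[of _ "\<lambda>(J, i). (insert i J, i)" "\<lambda>(I, i). (I - {i}, i)"])
    fix p assume "p \<in> Sigma (X (Suc j)) (\<lambda>I. I)"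
    moreover obtain I i where p: "p = (I, i)" by force
    ultimately have I: "I \<subseteq> {..<n}" "card I = Suc j" "i \<in> I" by (simp_all add: X_def)
    have "insert i (I - {i}) = I" "card (I - {i}) = j" "I - {i} \<subseteq> {..<n}" "i < n"
      using I by (simp_all add: insert_absorb) auto
    then show "(case case p of (I, i) \<Rightarrow> (I - {i}, i) of (J, i) \<Rightarrow> (insert i J, i)) = p"
      "(case p of (I, i) \<Rightarrow> (I - {i}, i)) \<in> Sigma (X j) (\<lambda>J. {..<n} - J)"
      "(case case p of (I, i) \<Rightarrow> (I - {i}, i) of (J, i) \<Rightarrow> \<Sum>b\<in>{1, -1}. G ((alternating n (insert i J))(i := b)))
        = (case p of (I, i) \<Rightarrow> \<Sum>b\<in>{1, -1}. G ((alternating n I)(i := b)))"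
      by (simp_all only: p prod.case X_def mem_Sigma_iff mem_Collect_eq) auto
  next
    fix p assume "p \<in> Sigma (X j) (\<lambda>J. {..<n} - J)"
    moreover obtain J i where p: "p = (J, i)" by force
    ultimately have "J \<in> X j" "i < n" "i \<notin> J" by simp_all
    then have J: "J \<subseteq> {..<n}" "card J = j" "i < n" "i \<notin> J" "finite J"
      using fin[of J j] by (simp_all add: X_def)
    then show "(case case p of (J, i) \<Rightarrow> (insert i J, i) of (I, i) \<Rightarrow> (I - {i}, i)) = p"
      "(case p of (J, i) \<Rightarrow> (insert i J, i)) \<in> Sigma (X (Suc j)) (\<lambda>I. I)"
      by (simp_all add: p X_def)
  qed
  also have "\<dots> = (\<Sum>(J, i)\<in>Sigma (X j) (\<lambda>J. {..<n} - J). G (alternating_jump n J i) + G (alternating_jump n J (Suc i)))"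
  proof (rule sum.cong[OF refl], clarify)
    fix J i assume J: "J \<in> X j" "i < n" "i \<notin> J"
    have inj: "inj_on (\<lambda>b. (alternating n (insert i J))(i := b)) {1, -1}"
      by (rule inj_onI) (metis fun_upd_same)
    have "(\<Sum>b\<in>{1, -1}. G ((alternating n (insert i J))(i := b)))
        = sum G ((\<lambda>b. (alternating n (insert i J))(i := b)) ` {1, -1})"
      by (subst sum.reindex[OF inj]) simp
    also have "\<dots> = G (alternating_jump n J i) + G (alternating_jump n J (Suc i))"
      unfolding alternating_insert(1)[OF J(2,3) fin[OF J(1)]] using alternating_insert(2)[OF J(2,3) fin[OF J(1)]] by simp
    finally show "(\<Sum>b\<in>{1, -1}. G ((alternating n (insert i J))(i := b)))
        = G (alternating_jump n J i) + G (alternating_jump n J (Suc i))" .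
  qed
  also have "\<dots> = (\<Sum>J\<in>X j. \<Sum>i\<in>{..<n} - J. G (alternating_jump n J i) + G (alternating_jump n J (Suc i)))"
    using finX by (subst sum.Sigma) auto
  also have "\<dots> = (\<Sum>J\<in>X j. \<Sum>i<n. G (alternating_jump n J i) + G (alternating_jump n J (Suc i)))"
    by (intro sum.cong sum.mono_neutral_left refl) (auto simp: alternating_jump_star)
  also have "\<dots> = (\<Sum>J\<in>X j. G (alternating n J) + G (\<lambda>p. - alternating n J p))"
    by (subst telescope_bit) (simp add: alternating_jump_0 alternating_jump_n add.commute)
  finally show ?thesis unfolding X_def .
qed

section \<open>An odd number of flags surrounds the origin\<close>

lemma meets_ray_uminus:
  fixes w :: "(nat \<Rightarrow> int) \<Rightarrow> nat \<Rightarrow> real"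
  assumes odd: "\<And>s i. s \<in> A \<Longrightarrow> w (\<lambda>p. - s p) i = - w s i"
  shows "meets_ray e w j ((\<lambda>s p. - s p) ` A) \<longleftrightarrow> meets_ray (- e) w j A"
proof -
  let ?N = "\<lambda>s p. - s p :: int"
  have inj: "inj_on ?N A" by (auto simp: inj_on_def fun_eq_iff)
  have eq: "lincomb w (?N ` A) c i = - lincomb w A (c \<circ> ?N) i" for c i
    unfolding lincomb_def sum.reindex[OF inj] by (simp add: odd sum_negf)
  show ?thesis
  proof
    assume "meets_ray e w j (?N ` A)"
    then obtain c where "\<forall>s\<in>?N ` A. c s \<ge> 0" "\<forall>i<j. lincomb w (?N ` A) c i = 0"
      "e * lincomb w (?N ` A) c j > 0"
      unfolding meets_ray_def by auto
    then show "meets_ray (- e) w j A" unfolding meets_ray_def eq by (intro exI[of _ "c \<circ> ?N"]) auto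
  next
    assume "meets_ray (- e) w j A"
    then obtain c where "\<forall>s\<in>A. c s \<ge> 0" "\<forall>i<j. lincomb w A c i = 0" "- e * lincomb w A c j > 0"
      unfolding meets_ray_def by auto
    then show "meets_ray e w j (?N ` A)"
      unfolding meets_ray_def eq by (intro exI[of _ "c \<circ> ?N"]) (auto simp: comp_def)
  qed
qed

text \<open>Induction on the dimension of the hemisphere. The cocycle identity and Stokes' theorem turn the
  count of flags surrounding the origin of \<open>\<real>\<^sup>j\<^sup>+\<^sup>1\<close> into a count, over the boundary of the hemisphere, of
  flags meeting the negative half of the last axis. The boundary consists of a lower hemisphere and
  its antipode. Because \<open>w\<close> is odd, the contribution of the antipode is the number of flags of the
  lower hemisphere meeting the positive half of the axis. Together they count the flags that surround the
  origin of \<open>\<real>\<^sup>j\<close>.\<close>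

lemma odd_number_of_surrounding_flags:
  assumes gp: "\<And>j I l. j < n \<Longrightarrow> I \<subseteq> {..<n} \<Longrightarrow> card I = j \<Longrightarrow> l \<in> flags n j (alternating n I)
      \<Longrightarrow> in_general_position w d (set l)"
    and odd: "\<And>s i. s \<in> sign_vectors n \<Longrightarrow> w (\<lambda>p. - s p) i = - w s i"
    and "j \<le> d" "j < n"
  shows "(\<Sum>I | I \<subseteq> {..<n} \<and> card I = j.
      flag_sum n j (\<lambda>l. of_bool (surrounds_0 w j (set l))) (alternating n I)) = 1"
  using assms(3,4)
proof (induction j)
  case 0
  have "{I. I \<subseteq> {..<n} \<and> card I = 0} = {{}}" by (auto dest: finite_subset)
  moreover have "surrounds_0 w 0 {s}" for s
    unfolding surrounds_0_def by (intro exI[of _ "\<lambda>_. 1"]) auto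
  ultimately show ?case by simp
next
  case (Suc j)
  define \<psi> :: "(nat \<Rightarrow> int) list \<Rightarrow> bit" where "\<psi> l = of_bool (meets_ray (-1) w j (set l))" for l
  have cob: "flag_sum n (Suc j) (\<lambda>l. of_bool (surrounds_0 w (Suc j) (set l))) (alternating n I)
      = flag_sum n (Suc j) (coboundary \<psi>) (alternating n I)" if I: "I \<subseteq> {..<n}" "card I = Suc j" for I
  proof (rule flag_sum_cong)
    fix l assume l: "l \<in> flags n (Suc j) (alternating n I)"
    have card: "card (set l) = Suc (Suc j)"
      using flags_distinct[OF l] flags_length[OF l] by (simp add: distinct_card)
    have "of_bool (surrounds_0 w (Suc j) (set l))
        = (\<Sum>x\<in>set l. of_bool (meets_ray (-1) w j (set l - {x})) :: bit)"
      by (rule surrounds_0_eq_sum_facets[OF gp[OF _ I l] _ card]) (use Suc.prems in auto)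
    also have "\<dots> = coboundary \<psi> l"
      using coboundary_set_function[OF flags_distinct[OF l], of "{}" "\<lambda>A. of_bool (meets_ray (-1) w j A)"]
      by (simp add: \<psi>_def[abs_def])
    finally show "of_bool (surrounds_0 w (Suc j) (set l)) = coboundary \<psi> l" .
  qed
  have glue: "flag_sum n j \<psi> (alternating n J) + flag_sum n j \<psi> (\<lambda>p. - alternating n J p)
      = flag_sum n j (\<lambda>l. of_bool (surrounds_0 w j (set l))) (alternating n J)"
    if J: "J \<subseteq> {..<n}" "card J = j" for J
    unfolding flag_sum_uminus flag_sum_add[symmetric]
  proof (rule flag_sum_cong)
    fix l assume l: "l \<in> flags n j (alternating n J)"
    have sv: "set l \<subseteq> sign_vectors n" using flags_sign_vectors[OF l] alternating_sign_vector by blast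
    have card: "card (set l) = Suc j"
      using flags_distinct[OF l] flags_length[OF l] by (simp add: distinct_card)
    have "\<psi> (map (\<lambda>s i. - s i) l) = of_bool (meets_ray 1 w j (set l))"
      using meets_ray_uminus[of "set l" w "-1" j] sv odd by (auto simp: \<psi>_def)
    moreover have "of_bool (surrounds_0 w j (set l))
        = of_bool (meets_ray 1 w j (set l)) + (of_bool (meets_ray (-1) w j (set l)) :: bit)"
      by (rule surrounds_0_eq_meets_rays[OF gp[OF _ J l] _ card]) (use Suc.prems in auto)
    ultimately show "\<psi> l + \<psi> (map (\<lambda>s i. - s i) l) = of_bool (surrounds_0 w j (set l))"
      by (simp only: \<psi>_def add.commute)
  qed
  have "(\<Sum>I | I \<subseteq> {..<n} \<and> card I = Suc j.
      flag_sum n (Suc j) (\<lambda>l. of_bool (surrounds_0 w (Suc j) (set l))) (alternating n I))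
    = (\<Sum>I | I \<subseteq> {..<n} \<and> card I = Suc j. \<Sum>i\<in>stars n (alternating n I). \<Sum>b\<in>{1, -1}.
        flag_sum n j \<psi> ((alternating n I)(i := b)))"
    unfolding flag_sum_coboundary[symmetric] by (intro sum.cong refl cob) auto
  also have "\<dots> = (\<Sum>J | J \<subseteq> {..<n} \<and> card J = j.
      flag_sum n j (\<lambda>l. of_bool (surrounds_0 w j (set l))) (alternating n J))"
    unfolding sum_boundary_alternating by (intro sum.cong refl glue) auto
  also have "\<dots> = 1" using Suc by simp
  finally show ?case .
qed

section \<open>General position by perturbation\<close>

text \<open>On a translate of the moment curve, a nonzero linear form is a nonconstant polynomial in the
  parameter.\<close>

lemma finite_moment_curve_hyperplane:
  fixes a z :: "nat \<Rightarrow> real"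
  assumes "\<exists>i<j. a i \<noteq> 0"
  shows "finite {t. (\<Sum>i<j. a i * (z i + t ^ Suc i)) = 0}"
proof -
  define q where "q = [:\<Sum>i<j. a i * z i:] + (\<Sum>i<j. monom (a i) (Suc i))"
  obtain k where k: "k < j" "a k \<noteq> 0" using assms by auto
  have "coeff q (Suc k) = (\<Sum>i<j. if i = k then a i else 0)"
    by (simp add: q_def coeff_sum del: sum.delta sum.delta')
  also have "\<dots> = a k" using k by (simp add: sum.delta)
  finally have "q \<noteq> 0" using k by auto
  moreover have "poly q t = (\<Sum>i<j. a i * (z i + t ^ Suc i))" for t
    by (simp add: q_def poly_sum poly_monom sum.distrib distrib_left)
  ultimately show ?thesis using poly_roots_finite[of q] by simp
qed

text \<open>The vectors are perturbed one after the other. The span of fewer than \<open>j\<close> earlier vectors in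
  \<open>\<real>\<^sup>j\<close> lies in a hyperplane; there are finitely many such conditions, and moving the new vector along a
  moment curve leaves all these hyperplanes at arbitrarily small parameters.\<close>

lemma ex_general_position_near:
  fixes w :: "'a \<Rightarrow> nat \<Rightarrow> real"
  assumes "finite R" "\<epsilon> > 0"
  shows "\<exists>w'. (\<forall>x\<in>R. \<forall>i<d. \<bar>w' x i - w x i\<bar> < \<epsilon>) \<and> in_general_position w' d R"
  using assms(1)
proof induction
  case empty
  then show ?case by (auto simp: in_general_position_def indep_def)
next
  case (insert x R)
  then obtain w' where near: "\<forall>x\<in>R. \<forall>i<d. \<bar>w' x i - w x i\<bar> < \<epsilon>" and gp: "in_general_position w' d R"
    by auto
  define P where "P = {(j, B). j \<le> d \<and> B \<subseteq> R \<and> card B < j}"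
  have "\<exists>a. (\<exists>i<j. a i \<noteq> 0) \<and> (\<forall>b\<in>B. (\<Sum>i<j. a i * w' b i) = 0)" if "(j, B) \<in> P" for j B
    using that underdetermined_system_solvable[of B "{..<j}" w'] insert.hyps(1)
    by (auto simp: P_def dest: finite_subset)
  then obtain a where a: "\<And>j B. (j, B) \<in> P \<Longrightarrow> \<exists>i<j. a j B i \<noteq> 0"
    "\<And>j B b. (j, B) \<in> P \<Longrightarrow> b \<in> B \<Longrightarrow> (\<Sum>i<j. a j B i * w' b i) = 0"
    by metis
  define T where "T = (\<Union>(j, B)\<in>P. {t. (\<Sum>i<j. a j B i * (w x i + t ^ Suc i)) = 0})"
  have "P \<subseteq> {..d} \<times> Pow R" by (auto simp: P_def)
  then have "finite P" by (rule finite_subset) (use insert.hyps in auto)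
  then have "finite T" unfolding T_def using finite_moment_curve_hyperplane a(1) by (auto split: prod.splits)
  moreover have "infinite {0<..<min \<epsilon> 1}" using assms(2) by (simp add: infinite_Ioo)
  ultimately have "{0<..<min \<epsilon> 1} - T \<noteq> {}" by (metis Diff_infinite_finite infinite_imp_nonempty)
  then obtain t where "t \<in> {0<..<min \<epsilon> 1} - T" by blast
  then have t: "0 < t" "t < \<epsilon>" "t < 1" "t \<notin> T" by auto
  define w'' where "w'' = w'(x := (\<lambda>i. w x i + t ^ Suc i))"
  have w''_R: "w'' y = w' y" if "y \<in> R" for y using that insert.hyps by (auto simp: w''_def)
  have "\<bar>w'' x i - w x i\<bar> < \<epsilon>" for i
  proof -
    have "t ^ Suc i \<le> t" using power_decreasing[of 1 "Suc i" t] t by simp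
    moreover have "\<bar>t ^ Suc i\<bar> = t ^ Suc i" using t by simp
    ultimately have "\<bar>t ^ Suc i\<bar> < \<epsilon>" using t by linarith
    then show ?thesis by (simp add: w''_def)
  qed
  then have "\<forall>y\<in>insert x R. \<forall>i<d. \<bar>w'' y i - w y i\<bar> < \<epsilon>" using near w''_R by auto
  moreover have "in_general_position w'' d (insert x R)"
    unfolding in_general_position_def
  proof (intro allI impI)
    fix j B assume j: "j \<le> d" and B: "B \<subseteq> insert x R" "finite B" "card B \<le> j"
    have old: "indep w'' j B'" if "B' \<subseteq> R" "finite B'" "card B' \<le> j" for B'
    proof -
      have "lincomb w'' B' c i = lincomb w' B' c i" for c i
        unfolding lincomb_def using that w''_R by (intro sum.cong) auto
      then show ?thesis using gp that j unfolding in_general_position_def indep_def by auto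
    qed
    show "indep w'' j B"
    proof (cases "x \<in> B")
      case False
      then show ?thesis using old[of B] B by auto
    next
      case True
      define B' where "B' = B - {x}"
      have B': "B = insert x B'" "x \<notin> B'" "B' \<subseteq> R" "finite B'" "card B' < j"
        using True B by (auto simp: B'_def card_Diff_singleton card_gt_0_iff
            intro: order_less_le_trans[OF diff_less])
      then have P: "(j, B') \<in> P" using j by (simp add: P_def)
      show ?thesis unfolding indep_def
      proof (intro allI impI)
        fix c assume c: "\<forall>i<j. lincomb w'' B c i = 0"
        have "0 = (\<Sum>i<j. a j B' i * lincomb w'' B c i)" using c by simp
        also have "\<dots> = (\<Sum>i<j. \<Sum>y\<in>B. c y * (a j B' i * w'' y i))"
          by (simp add: lincomb_def sum_distrib_left mult.left_commute)
        also have "\<dots> = (\<Sum>y\<in>B. c y * (\<Sum>i<j. a j B' i * w'' y i))"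
          by (subst sum.swap) (simp add: sum_distrib_left)
        also have "\<dots> = c x * (\<Sum>i<j. a j B' i * w'' x i)
            + (\<Sum>y\<in>B'. c y * (\<Sum>i<j. a j B' i * w'' y i))"
          using B' by simp
        also have "(\<Sum>y\<in>B'. c y * (\<Sum>i<j. a j B' i * w'' y i)) = 0"
          using a(2)[OF P] w''_R B' by (intro sum.neutral) auto
        finally have "c x * (\<Sum>i<j. a j B' i * (w x i + t ^ Suc i)) = 0" by (simp add: w''_def)
        moreover have "(\<Sum>i<j. a j B' i * (w x i + t ^ Suc i)) \<noteq> 0"
          using t(4) P unfolding T_def by blast
        ultimately have "c x = 0" by simp
        then have "lincomb w'' B' c i = 0" if "i < j" for i
          using c that B' by (simp add: lincomb_def)
        then have "\<forall>y\<in>B'. c y = 0" using old[of B'] B' unfolding indep_def by auto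
        then show "\<forall>y\<in>B. c y = 0" using \<open>c x = 0\<close> B' by auto
      qed
    qed
  qed
  ultimately show ?case by blast
qed

lemma in_general_position_rescale:
  assumes gp: "in_general_position w d R" and inj: "inj_on f A" and sub: "f ` A \<subseteq> R"
    and e: "\<And>s. s \<in> A \<Longrightarrow> e s \<noteq> 0" "\<And>s i. s \<in> A \<Longrightarrow> w' s i = e s * w (f s) i"
  shows "in_general_position w' d A"
  unfolding in_general_position_def
proof (intro allI impI)
  fix j B assume j: "j \<le> d" and B: "B \<subseteq> A" "finite B" "card B \<le> j"
  have injB: "inj_on f B" using inj B inj_on_subset by blast
  have ind: "indep w j (f ` B)"
    using gp j B sub card_image[OF injB] unfolding in_general_position_def by (metis finite_imageI image_mono order_trans)
  show "indep w' j B" unfolding indep_def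
  proof (intro allI impI ballI)
    fix c s assume c: "\<forall>i<j. lincomb w' B c i = 0" and s: "s \<in> B"
    define c' where "c' x = c (inv_into B f x) * e (inv_into B f x)" for x
    have c': "c' (f s) = c s * e s" if "s \<in> B" for s
      using injB that by (simp add: c'_def)
    have "lincomb w (f ` B) c' i = lincomb w' B c i" for i
      unfolding lincomb_def sum.reindex[OF injB] using B(1) by (intro sum.cong) (auto simp: c' e)
    then have "c' (f s) = 0" using ind c s unfolding indep_def by simp
    then show "c s = 0" using c'[OF s] e(1)[of s] B(1) s by auto
  qed
qed

text \<open>The first nonzero sign, which tells a sign vector from its antipode; it is \<open>0\<close> for the zero vector,
  where the least index is an arbitrary number.\<close>

definition lead :: "(nat \<Rightarrow> int) \<Rightarrow> int" where
  "lead s = s (LEAST i. s i \<noteq> 0)"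

lemma lead_uminus [simp]: "lead (\<lambda>i. - s i) = - lead s"
  by (simp add: lead_def)

lemma lead_cases:
  assumes "s \<in> sign_vectors n"
  shows "lead s \<in> {1, -1} \<or> (s = (\<lambda>_. 0) \<and> lead s = 0)"
proof (cases "\<exists>i. s i \<noteq> 0")
  case True
  then have "lead s \<noteq> 0" unfolding lead_def by (rule LeastI_ex)
  moreover have "s i \<in> {-1, 0, 1}" for i
    using assms by (cases "i < n") (auto simp: sign_vectors_def)
  ultimately show ?thesis by (auto simp: lead_def)
qed (auto simp: lead_def)

lemma finite_sign_vectors: "finite (sign_vectors n)"
proof -
  have "sign_vectors n \<subseteq> {s. \<forall>i. (i \<in> {..<n} \<longrightarrow> s i \<in> {-1, 0, 1}) \<and> (i \<notin> {..<n} \<longrightarrow> s i = 0)}"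
    by (auto simp: sign_vectors_def)
  then show ?thesis by (rule finite_subset) (intro finite_set_of_finite_funs, auto)
qed

text \<open>A perturbation of the vectors with leading sign 1 is extended to an odd family. Oddness makes
  antipodal vectors dependent, so general position can hold only for sets without antipodal pairs; a
  common nonzero sign at one position excludes them.\<close>

lemma ex_odd_general_position_near:
  fixes w :: "(nat \<Rightarrow> int) \<Rightarrow> nat \<Rightarrow> real"
  assumes odd: "\<And>s i. s \<in> sign_vectors n \<Longrightarrow> w (\<lambda>p. - s p) i = - w s i" and "\<epsilon> > 0"
  obtains w' where "\<forall>s\<in>sign_vectors n. \<forall>i. w' (\<lambda>p. - s p) i = - w' s i"
    and "\<forall>s\<in>sign_vectors n. \<forall>i<d. \<bar>w' s i - w s i\<bar> < \<epsilon>"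
    and "\<forall>p e. e \<noteq> 0 \<longrightarrow> in_general_position w' d {s \<in> sign_vectors n. s p = e}"
proof -
  from ex_general_position_near[OF finite_sign_vectors[of n] \<open>\<epsilon> > 0\<close>, of d w]
  obtain w1 where w1: "\<And>s i. s \<in> sign_vectors n \<Longrightarrow> i < d \<Longrightarrow> \<bar>w1 s i - w s i\<bar> < \<epsilon>"
    and gp: "in_general_position w1 d (sign_vectors n)"
    by auto
  define f where "f s = (\<lambda>p. lead s * s p)" for s
  define w' where "w' s i = real_of_int (lead s) * w1 (f s) i" for s i
  have f_sv: "f s \<in> sign_vectors n" if "s \<in> sign_vectors n" for s
    using lead_cases[OF that] that by (auto simp: f_def sign_vectors_def)
  have "f (\<lambda>p. - s p) = f s" for s by (simp add: f_def)
  then have odd': "w' (\<lambda>p. - s p) i = - w' s i" for s i by (simp add: w'_def)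
  have near': "\<bar>w' s i - w s i\<bar> < \<epsilon>" if s: "s \<in> sign_vectors n" and "i < d" for s i
    using lead_cases[OF s]
  proof (elim disjE)
    assume "lead s \<in> {1, -1}"
    then have "w' s i = lead s * w1 (f s) i" "w s i = lead s * w (f s) i" "\<bar>lead s\<bar> = 1"
      using odd[OF s, of i] by (auto simp: w'_def f_def)
    then have "w' s i - w s i = lead s * (w1 (f s) i - w (f s) i)" by (simp add: right_diff_distrib)
    then have "\<bar>w' s i - w s i\<bar> = \<bar>w1 (f s) i - w (f s) i\<bar>"
      using \<open>\<bar>lead s\<bar> = 1\<close> by (auto simp: abs_mult)
    then show ?thesis using w1[OF f_sv[OF s] \<open>i < d\<close>] by simp
  next
    assume z: "s = (\<lambda>_. 0) \<and> lead s = 0"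
    then have "w s i = 0" using odd[OF s, of i] by simp
    moreover have "lead (\<lambda>_. 0) = 0" using z by metis
    ultimately show ?thesis using z \<open>\<epsilon> > 0\<close> by (simp add: w'_def)
  qed
  have gp': "in_general_position w' d {s \<in> sign_vectors n. s p = e}" (is "in_general_position _ _ ?A")
    if "e \<noteq> 0" for p and e :: int
  proof (rule in_general_position_rescale[OF gp])
    have lead: "lead s = 1 \<or> lead s = -1" if "s \<in> ?A" for s
      using lead_cases[of s n] that \<open>e \<noteq> 0\<close> by auto
    show "inj_on f ?A"
    proof (rule inj_onI)
      fix s t assume st: "s \<in> ?A" "t \<in> ?A" "f s = f t"
      have "lead s * s p = lead t * t p" using st(3) unfolding f_def by metis
      then have "lead s = lead t" using st(1,2) \<open>e \<noteq> 0\<close> by simp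
      show "s = t"
      proof
        fix q
        have "lead s * s q = lead t * t q" using st(3) unfolding f_def by metis
        then show "s q = t q" using \<open>lead s = lead t\<close> lead[OF st(2)] by auto
      qed
    qed
    show "f ` ?A \<subseteq> sign_vectors n" using f_sv by auto
    show "real_of_int (lead s) \<noteq> 0" if "s \<in> ?A" for s using lead[OF that] by auto
  qed (simp add: w'_def)
  show thesis
  proof (rule that)
    show "\<forall>s\<in>sign_vectors n. \<forall>i. w' (\<lambda>p. - s p) i = - w' s i" using odd' by simp
    show "\<forall>s\<in>sign_vectors n. \<forall>i<d. \<bar>w' s i - w s i\<bar> < \<epsilon>" using near' by simp
    show "\<forall>p e. e \<noteq> 0 \<longrightarrow> in_general_position w' d {s \<in> sign_vectors n. s p = e}" using gp' by simp
  qed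
qed

section \<open>A Borsuk-Ulam theorem for flags of cube faces\<close>

text \<open>A version of the Borsuk--Ulam theorem: an odd map from a sphere of dimension \<open>d\<close> to \<open>\<real>\<^sup>d\<close> that is
  affine on the simplices has a zero, so the images of the vertices of some simplex are not contained
  in an open half-space. Being contained in an open half-space survives small perturbations of the
  finitely many vectors, so the case of general position suffices.\<close>

theorem ex_flag_not_in_open_halfspace:
  fixes w :: "(nat \<Rightarrow> int) \<Rightarrow> nat \<Rightarrow> real"
  assumes "d < n" and odd: "\<And>s i. s \<in> sign_vectors n \<Longrightarrow> w (\<lambda>p. - s p) i = - w s i"
  obtains I l where "I \<subseteq> {..<n}" "card I = d" "l \<in> flags n d (alternating n I)"
    "\<forall>v. \<exists>s\<in>set l. (\<Sum>i<d. w s i * v i) \<le> 0"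
proof (rule ccontr)
  note found = that
  assume contra: "\<not> thesis"
  define L where "L = (\<Union>I\<in>{I. I \<subseteq> {..<n} \<and> card I = d}. flags n d (alternating n I))"
  have "finite L" unfolding L_def by (auto intro: finite_flags)
  have "\<exists>v. \<forall>s\<in>set l. (\<Sum>i<d. w s i * v i) > 0" if l: "l \<in> L" for l
  proof (rule ccontr)
    assume "\<not> ?thesis"
    then have "\<exists>s\<in>set l. (\<Sum>i<d. w s i * v i) \<le> 0" for v by (meson not_le)
    moreover obtain I where "I \<subseteq> {..<n}" "card I = d" "l \<in> flags n d (alternating n I)"
      using l by (auto simp: L_def)
    ultimately show False using contra found by blast
  qed
  then obtain v where v: "\<And>l s. l \<in> L \<Longrightarrow> s \<in> set l \<Longrightarrow> (\<Sum>i<d. w s i * v l i) > 0" by metis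
  have "\<forall>\<^sub>F e in at_right 0. \<forall>l\<in>L. \<forall>s\<in>set l. e * (\<Sum>i<d. \<bar>v l i\<bar>) < (\<Sum>i<d. w s i * v l i)"
  proof (intro eventually_ball_finite \<open>finite L\<close> ballI finite_set)
    fix l s assume "l \<in> L" "s \<in> set l"
    have "((\<lambda>e. e * (\<Sum>i<d. \<bar>v l i\<bar>)) \<longlongrightarrow> 0 * (\<Sum>i<d. \<bar>v l i\<bar>)) (at_right 0)" by (intro tendsto_intros)
    then show "\<forall>\<^sub>F e in at_right 0. e * (\<Sum>i<d. \<bar>v l i\<bar>) < (\<Sum>i<d. w s i * v l i)"
      using v[OF \<open>l \<in> L\<close> \<open>s \<in> set l\<close>] by (auto intro: order_tendstoD)
  qed
  then have "\<forall>\<^sub>F e in at_right 0. e > 0 \<and>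
      (\<forall>l\<in>L. \<forall>s\<in>set l. e * (\<Sum>i<d. \<bar>v l i\<bar>) < (\<Sum>i<d. w s i * v l i))"
    by (intro eventually_conj eventually_at_right_less)
  then obtain \<epsilon> :: real where eps: "\<epsilon> > 0"
    "\<And>l s. l \<in> L \<Longrightarrow> s \<in> set l \<Longrightarrow> \<epsilon> * (\<Sum>i<d. \<bar>v l i\<bar>) < (\<Sum>i<d. w s i * v l i)"
    using eventually_happens' trivial_limit_at_right_real by blast
  obtain w' where w': "\<forall>s\<in>sign_vectors n. \<forall>i. w' (\<lambda>p. - s p) i = - w' s i"
    and near: "\<forall>s\<in>sign_vectors n. \<forall>i<d. \<bar>w' s i - w s i\<bar> < \<epsilon>"
    and gp: "\<forall>p e. e \<noteq> 0 \<longrightarrow> in_general_position w' d {s \<in> sign_vectors n. s p = e}"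
    by (rule ex_odd_general_position_near[where n = n and w = w and \<epsilon> = \<epsilon> and d = d, OF assms(2) eps(1)])
  have sv: "set l \<subseteq> sign_vectors n" if "l \<in> flags n j (alternating n I)" for l j I
    using flags_sign_vectors[OF that] alternating_sign_vector by blast
  have "in_general_position w' d (set l)"
    if j: "j < n" "I \<subseteq> {..<n}" "card I = j" "l \<in> flags n j (alternating n I)" for j I l
  proof -
    have "I \<noteq> {..<n}" using j by auto
    then obtain p where "p < n" "p \<notin> I" using j(2) by blast
    then have "alternating n I p \<noteq> 0" by (simp add: alternating_def)
    moreover from this have "set l \<subseteq> {s \<in> sign_vectors n. s p = alternating n I p}"
      using flags_extend[OF j(4)] sv[OF j(4)] by blast
    ultimately show ?thesis using gp in_general_position_subset by blast
  qed
  then have "(\<Sum>I | I \<subseteq> {..<n} \<and> card I = d.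
      flag_sum n d (\<lambda>l. of_bool (surrounds_0 w' d (set l))) (alternating n I)) = 1"
    using w' \<open>d < n\<close> by (intro odd_number_of_surrounding_flags[where d = d]) auto
  then obtain I where I: "I \<subseteq> {..<n}" "card I = d"
    "flag_sum n d (\<lambda>l. of_bool (surrounds_0 w' d (set l))) (alternating n I) \<noteq> 0"
    by (metis (mono_tags, lifting) mem_Collect_eq sum.neutral zero_neq_one)
  from flag_sum_nonzeroE[OF I(3)] obtain l where l: "l \<in> flags n d (alternating n I)" "surrounds_0 w' d (set l)"
    by (metis of_bool_eq(1))
  then have "l \<in> L" using I by (auto simp: L_def)
  obtain c where c: "\<forall>s\<in>set l. c s \<ge> 0" "\<exists>s\<in>set l. c s > 0" "\<forall>i<d. lincomb w' (set l) c i = 0"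
    using l(2) unfolding surrounds_0_def by auto
  from c(2) obtain s0 where s0: "s0 \<in> set l" "c s0 > 0" by auto
  have pos: "(\<Sum>i<d. w' s i * v l i) > 0" if s: "s \<in> set l" for s
  proof -
    have "s \<in> sign_vectors n" using sv[OF l(1)] s by auto
    have "(\<Sum>i<d. w s i * v l i) - (\<Sum>i<d. w' s i * v l i) = (\<Sum>i<d. (w s i - w' s i) * v l i)"
      by (simp add: left_diff_distrib sum_subtractf)
    also have "\<dots> \<le> (\<Sum>i<d. \<epsilon> * \<bar>v l i\<bar>)"
    proof (rule sum_mono)
      fix i assume "i \<in> {..<d}"
      then have "\<bar>w s i - w' s i\<bar> \<le> \<epsilon>" using near \<open>s \<in> sign_vectors n\<close> by (auto simp: abs_minus_commute less_imp_le)
      then have "\<bar>w s i - w' s i\<bar> * \<bar>v l i\<bar> \<le> \<epsilon> * \<bar>v l i\<bar>" by (rule mult_right_mono) simp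
      then show "(w s i - w' s i) * v l i \<le> \<epsilon> * \<bar>v l i\<bar>" by (metis abs_le_D1 abs_mult)
    qed
    also have "\<dots> = \<epsilon> * (\<Sum>i<d. \<bar>v l i\<bar>)" by (simp add: sum_distrib_left)
    finally show ?thesis using eps(2)[OF \<open>l \<in> L\<close> s] by linarith
  qed
  have "0 = (\<Sum>i<d. lincomb w' (set l) c i * v l i)" using c(3) by simp
  also have "\<dots> = (\<Sum>s\<in>set l. c s * (\<Sum>i<d. w' s i * v l i))"
    unfolding lincomb_def sum_distrib_left sum_distrib_right by (subst sum.swap) (simp add: mult.assoc)
  also have "\<dots> > 0"
  proof (rule sum_pos2)
    show "finite (set l)" "s0 \<in> set l" by (auto intro: s0(1))
    show "0 < c s0 * (\<Sum>i<d. w' s0 i * v l i)" using s0 pos by simp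
    show "0 \<le> c s * (\<Sum>i<d. w' s i * v l i)" if "s \<in> set l" for s
      using c(1) that pos[OF that] by simp
  qed
  finally show False by simp
qed

section \<open>Balanced centres\<close>

lemma cosh_le_exp_square:
  fixes x :: real
  assumes "0 \<le> x" "x \<le> 1"
  shows "cosh x \<le> exp (x\<^sup>2)"
proof -
  have "exp x \<le> 1 + x + x\<^sup>2" by (rule exp_bound) (use assms in auto)
  moreover have "exp (- x) \<le> 1 - x + x\<^sup>2"
  proof -
    have "1 \<le> 1 + x ^ 3" using assms by simp
    also have "\<dots> = (1 + x) * (1 - x + x\<^sup>2)" by (simp add: algebra_simps power2_eq_square power3_eq_cube)
    also have "\<dots> \<le> exp x * (1 - x + x\<^sup>2)"
      by (rule mult_right_mono) (use assms exp_ge_add_one_self[of x] in auto)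
    finally show ?thesis by (simp add: exp_minus field_simps)
  qed
  ultimately have "cosh x \<le> 1 + x\<^sup>2" by (simp add: cosh_def)
  also have "\<dots> \<le> exp (x\<^sup>2)" by (rule exp_ge_add_one_self)
  finally show ?thesis .
qed

text \<open>The coordinates of \<open>y\<close> are chosen one at a time. Averaged over the two choices, a coordinate
  multiplies each exponential by \<open>cosh \<tau>\<close>, so one of the two choices does not exceed the average.\<close>

lemma ex_low_potential_centre:
  fixes X :: "('a \<Rightarrow> nat) set" and \<tau> :: real
  assumes "finite I" and X: "\<And>x i. x \<in> X \<Longrightarrow> i \<in> I \<Longrightarrow> x i \<in> {0, 1}"
  shows "\<exists>y. (\<forall>i\<in>I. y i \<in> {0, 1 :: nat}) \<and>
    (\<Sum>x\<in>X. exp (\<tau> * (\<Sum>i\<in>I. if x i \<noteq> y i then 1 else -1))) \<le> card X * cosh \<tau> ^ card I"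
  using assms
proof (induction I rule: finite_induct)
  case empty
  then show ?case by simp
next
  case (insert k I)
  define E where "E y x = exp (\<tau> * (\<Sum>i\<in>I. if x i \<noteq> y i then 1 else -1))" for x y :: "'a \<Rightarrow> nat"
  define f where "f b x = exp (\<tau> * (if x k \<noteq> b then 1 else -1))" for x :: "'a \<Rightarrow> nat" and b
  obtain y where y: "\<forall>i\<in>I. y i \<in> {0, 1}" "(\<Sum>x\<in>X. E y x) \<le> card X * cosh \<tau> ^ card I"
    using insert unfolding E_def by (metis (lifting) insertI2)
  have "(\<Sum>x\<in>X. E y x * f 0 x) + (\<Sum>x\<in>X. E y x * f 1 x) = (\<Sum>x\<in>X. E y x * (2 * cosh \<tau>))"
    unfolding sum.distrib[symmetric]
  proof (intro sum.cong refl)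
    fix x assume "x \<in> X"
    then have "f 0 x + f 1 x = 2 * cosh \<tau>"
      using insert.prems[of x k] by (auto simp: f_def cosh_def)
    then show "E y x * f 0 x + E y x * f 1 x = E y x * (2 * cosh \<tau>)"
      by (simp add: distrib_left[symmetric])
  qed
  also have "\<dots> = 2 * (cosh \<tau> * (\<Sum>x\<in>X. E y x))" by (simp add: sum_distrib_left mult_ac)
  also have "\<dots> \<le> 2 * (cosh \<tau> * (card X * cosh \<tau> ^ card I))"
    using y(2) by (intro mult_left_mono) auto
  also have "\<dots> = 2 * (card X * cosh \<tau> ^ card (insert k I))" using insert.hyps by simp
  finally have "(\<Sum>x\<in>X. E y x * f 0 x) \<le> card X * cosh \<tau> ^ card (insert k I)
      \<or> (\<Sum>x\<in>X. E y x * f 1 x) \<le> card X * cosh \<tau> ^ card (insert k I)" by linarith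
  then obtain b where b: "b \<in> {0, 1}"
    "(\<Sum>x\<in>X. E y x * f b x) \<le> card X * cosh \<tau> ^ card (insert k I)" by blast
  have "exp (\<tau> * (\<Sum>i\<in>insert k I. if x i \<noteq> (y(k := b)) i then 1 else -1)) = E y x * f b x" for x
  proof -
    have "(\<Sum>i\<in>I. if x i \<noteq> (y(k := b)) i then 1 else -1 :: real) = (\<Sum>i\<in>I. if x i \<noteq> y i then 1 else -1)"
      using insert.hyps by (intro sum.cong) auto
    then show ?thesis
      using insert.hyps by (simp add: E_def f_def exp_add[symmetric] distrib_left)
  qed
  then show ?case using b y(1) insert.hyps by (intro exI[of _ "y(k := b)"]) auto
qed

text \<open>Any \<open>M\<close> points of a cube of dimension \<open>d\<close> lie in a Hamming ball of radius only slightly above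
  \<open>d / 2\<close>: a single exponential is at most the whole potential, and \<open>cosh \<tau> \<le> exp (\<tau>\<^sup>2)\<close>.\<close>

lemma ex_balanced_centre:
  fixes X :: "('a \<Rightarrow> nat) set" and \<tau> M :: real
  assumes "finite I" "finite X" and X: "\<And>x i. x \<in> X \<Longrightarrow> i \<in> I \<Longrightarrow> x i \<in> {0, 1}"
    and M: "card X \<le> M" and lam: "0 < \<tau>" "\<tau> \<le> 1"
  obtains y where "\<forall>i\<in>I. y i \<in> {0, 1}"
    "\<forall>x\<in>X. real (card {i\<in>I. x i \<noteq> y i}) \<le> card I / 2 + (ln M / \<tau> + \<tau> * card I) / 2"
proof -
  obtain y where y: "\<forall>i\<in>I. y i \<in> {0, 1}"
    "(\<Sum>x\<in>X. exp (\<tau> * (\<Sum>i\<in>I. if x i \<noteq> y i then 1 else -1))) \<le> card X * cosh \<tau> ^ card I"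
    using ex_low_potential_centre[of I X \<tau>] assms(1) X by blast
  have "real (card {i\<in>I. x i \<noteq> y i}) \<le> card I / 2 + (ln M / \<tau> + \<tau> * card I) / 2" if x: "x \<in> X" for x
  proof -
    define D where "D = real (card {i\<in>I. x i \<noteq> y i})"
    have "M > 0" using x assms(2) M by (metis card_gt_0_iff empty_iff of_nat_0_less_iff order_less_le_trans)
    have "(\<Sum>i\<in>I. if x i \<noteq> y i then 1 else -1) = (\<Sum>i\<in>I. 2 * (if x i \<noteq> y i then 1 else 0) - 1 :: real)"
      by (intro sum.cong) auto
    also have "\<dots> = 2 * D - card I"
      using assms(1) by (simp add: D_def sum_subtractf sum_distrib_left[symmetric] sum.If_cases Int_def)
    finally have "exp (\<tau> * (2 * D - card I)) = exp (\<tau> * (\<Sum>i\<in>I. if x i \<noteq> y i then 1 else -1))" by simp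
    also have "\<dots> \<le> (\<Sum>x\<in>X. exp (\<tau> * (\<Sum>i\<in>I. if x i \<noteq> y i then 1 else -1)))"
      by (rule member_le_sum[OF x]) (use assms in auto)
    also have "\<dots> \<le> card X * cosh \<tau> ^ card I" by (rule y(2))
    also have "\<dots> \<le> M * exp (\<tau>\<^sup>2) ^ card I"
      using M lam cosh_le_exp_square[of \<tau>] \<open>M > 0\<close> by (intro mult_mono power_mono) auto
    also have "\<dots> = exp (ln M + \<tau>\<^sup>2 * card I)"
      using \<open>M > 0\<close> by (simp add: exp_add exp_of_nat_mult[symmetric] mult.commute)
    finally have "\<tau> * (2 * D - card I) \<le> ln M + \<tau>\<^sup>2 * card I"
      by (simp only: exp_le_cancel_iff)
    also have "\<dots> = \<tau> * (ln M / \<tau> + \<tau> * card I)"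
      using lam by (simp add: distrib_left power2_eq_square mult.assoc)
    finally have "2 * D - card I \<le> ln M / \<tau> + \<tau> * card I"
      using lam by (simp only: mult_le_cancel_left_pos)
    then show ?thesis unfolding D_def by argo
  qed
  with y(1) show thesis by (intro that) auto
qed

section \<open>Sign representations of the Gap Hamming Distance matrix\<close>

text \<open>A vertex of the face \<open>s\<close>, with sign \<open>1\<close> read as the bit 1 and sign \<open>-1\<close> as 0. Filling the stars
  with the leading sign makes the choice commute with the antipodal map.\<close>

definition vertex :: "nat \<Rightarrow> (nat \<Rightarrow> int) \<Rightarrow> nat \<Rightarrow> nat" where
  "vertex n s = (\<lambda>i\<in>{..<n}. if (if s i = 0 then lead s else s i) > 0 then 1 else 0)"

lemma vertex_cube: "vertex n s \<in> cube n"
  by (auto simp: vertex_def cube_def)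

lemma hamming_dist_vertex_uminus:
  assumes "s \<in> sign_vectors n" "s \<noteq> (\<lambda>_. 0)" "y \<in> cube n"
  shows "hamming_dist n (vertex n (\<lambda>i. - s i)) y = n - hamming_dist n (vertex n s) y"
proof -
  have "lead s \<noteq> 0" using lead_cases[OF assms(1)] assms(2) by auto
  then have "vertex n (\<lambda>i. - s i) i \<noteq> y i \<longleftrightarrow> vertex n s i = y i" if "i < n" for i
  proof -
    have "y i = 0 \<or> y i = 1" using that assms(3) by (auto simp: cube_def PiE_iff)
    then show ?thesis using that \<open>lead s \<noteq> 0\<close> by (auto simp: vertex_def)
  qed
  then have "{i. i < n \<and> vertex n (\<lambda>i. - s i) i \<noteq> y i} = {..<n} - {i. i < n \<and> vertex n s i \<noteq> y i}"
    by auto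
  then show ?thesis unfolding hamming_dist_def by (simp add: card_Diff_subset subset_iff)
qed

text \<open>If a column \<open>y\<close> were within distance \<open>k\<close> of all vertices of a flag, then it would be at distance
  at least \<open>n - k\<close> from their antipodes, so \<open>v y\<close> would have positive inner product with the difference
  of the vectors of each vertex and its antipode. These differences form an odd family,
  so for some flag of a face of dimension \<open>d\<close> there is no such \<open>y\<close>.\<close>

lemma sign_representable_GHD_uncentred:
  assumes rep: "sign_representable (cube n) (cube n) (GHD k n) d" and "d < n" "2 * k < n"
  obtains I X z where "I \<subseteq> {..<n}" "card I = d" "X \<subseteq> cube n" "finite X" "card X \<le> Suc d"
    "\<forall>x\<in>X. \<forall>i\<in>{..<n} - I. x i = z i" "\<forall>y\<in>cube n. \<exists>x\<in>X. hamming_dist n x y > k"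
proof -
  obtain u v where
    plus: "\<And>x y. x \<in> cube n \<Longrightarrow> y \<in> cube n \<Longrightarrow> GHD k n x y = Plus \<Longrightarrow> sgn (inner_prod d (u x) (v y)) = 1" and
    minus: "\<And>x y. x \<in> cube n \<Longrightarrow> y \<in> cube n \<Longrightarrow> GHD k n x y = Minus \<Longrightarrow> sgn (inner_prod d (u x) (v y)) = -1"
    using rep unfolding sign_representable_def by blast
  define w where "w s i = u (vertex n s) i - u (vertex n (\<lambda>i. - s i)) i" for s i
  have odd: "w (\<lambda>p. - s p) i = - w s i" for s i by (simp add: w_def)
  obtain I l where I: "I \<subseteq> {..<n}" "card I = d" and l: "l \<in> flags n d (alternating n I)"
    and zero: "\<forall>v. \<exists>s\<in>set l. (\<Sum>i<d. w s i * v i) \<le> 0"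
    by (rule ex_flag_not_in_open_halfspace[where w = w, OF \<open>d < n\<close> odd])
  have fixed: "s i = alternating n I i" "alternating n I i \<noteq> 0" if "s \<in> set l" "i \<in> {..<n} - I" for s i
  proof -
    show "alternating n I i \<noteq> 0" using that(2) by (auto simp: alternating_def)
    then show "s i = alternating n I i" using flags_extend[OF l that(1)] by blast
  qed
  have "I \<noteq> {..<n}" using I \<open>d < n\<close> by auto
  then obtain p where p: "p \<in> {..<n} - I" using I(1) by blast
  have s_ok: "s \<in> sign_vectors n" "s \<noteq> (\<lambda>_. 0)" if "s \<in> set l" for s
  proof -
    show "s \<in> sign_vectors n" using flags_sign_vectors[OF l alternating_sign_vector] that by blast
    show "s \<noteq> (\<lambda>_. 0)" using fixed[OF that p] by auto
  qed
  show thesis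
  proof (rule that[of I "vertex n ` set l" "\<lambda>i. if alternating n I i > 0 then 1 else 0"])
    show "card (vertex n ` set l) \<le> Suc d"
      using card_image_le[of "set l" "vertex n"] card_length[of l] flags_length[OF l] by simp
    show "\<forall>x\<in>vertex n ` set l. \<forall>i\<in>{..<n} - I. x i = (if alternating n I i > 0 then 1 else 0)"
      using fixed by (auto simp: vertex_def)
    show "\<forall>y\<in>cube n. \<exists>x\<in>vertex n ` set l. hamming_dist n x y > k"
    proof (rule ballI, rule ccontr)
      fix y assume y: "y \<in> cube n"
      assume "\<not> (\<exists>x\<in>vertex n ` set l. hamming_dist n x y > k)"
      then have close: "hamming_dist n (vertex n s) y \<le> k" if "s \<in> set l" for s using that by auto
      have "(\<Sum>i<d. w s i * v y i) > 0" if s: "s \<in> set l" for s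
      proof -
        have "GHD k n (vertex n s) y = Plus" using close[OF s] by (simp add: GHD_def)
        then have 1: "inner_prod d (u (vertex n s)) (v y) > 0"
          using plus[OF vertex_cube y] by (simp add: sgn_1_pos)
        have "hamming_dist n (vertex n (\<lambda>i. - s i)) y \<ge> n - k"
          using close[OF s] hamming_dist_vertex_uminus[OF s_ok[OF s] y] by simp
        then have "GHD k n (vertex n (\<lambda>i. - s i)) y = Minus"
          using \<open>2 * k < n\<close> by (simp add: GHD_def)
        then have 2: "inner_prod d (u (vertex n (\<lambda>i. - s i))) (v y) < 0"
          using minus[OF vertex_cube y] by (simp add: sgn_1_neg)
        have "(\<Sum>i<d. w s i * v y i)
            = inner_prod d (u (vertex n s)) (v y) - inner_prod d (u (vertex n (\<lambda>i. - s i))) (v y)"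
          by (simp add: w_def inner_prod_def left_diff_distrib sum_subtractf)
        then show ?thesis using 1 2 by simp
      qed
      then show False using zero by (metis not_le)
    qed
  qed (use I vertex_cube in auto)
qed

text \<open>The \<open>d + 1\<close> vertices just found differ only on \<open>d\<close> coordinates, so they have a centre at distance
  about \<open>d / 2\<close>, which must exceed \<open>k\<close>. With \<open>\<tau> = sqrt (ln k / k)\<close> the two error terms \<open>ln M / \<tau>\<close> and
  \<open>\<tau> * d\<close> are both at most \<open>2 * \<tau> * k\<close>, where \<open>M = k\<^sup>2\<close> bounds the number of vertices because
  \<open>d + 1 \<le> 2 * k \<le> k\<^sup>2\<close>.\<close>

lemma sign_representable_GHD_bound:
  assumes rep: "sign_representable (cube n) (cube n) (GHD k n) d" and "k \<ge> 2" "2 * k < n"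
  shows "real d \<ge> (1 - 2 * sqrt (ln (real k) / real k)) * (2 * real k)"
proof (rule ccontr)
  define \<tau> where "\<tau> = sqrt (ln (real k) / real k)"
  have ln_k: "0 < ln (real k)" "ln (real k) \<le> real k"
    using \<open>k \<ge> 2\<close> ln_bound[of "real k"] by auto
  have lam: "0 < \<tau>" "\<tau> \<le> 1" using ln_k \<open>k \<ge> 2\<close> by (auto simp: \<tau>_def)
  have "\<tau>\<^sup>2 = ln (real k) / real k" using ln_k by (simp add: \<tau>_def)
  then have ln_eq: "ln (real k) / \<tau> = \<tau> * k"
    using lam \<open>k \<ge> 2\<close> by (simp add: field_simps power2_eq_square)
  assume "\<not> ?thesis"
  then have d: "real d < 2 * real k - 4 * (\<tau> * k)" by (simp add: \<tau>_def algebra_simps)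
  moreover have "0 < \<tau> * real k" using lam \<open>k \<ge> 2\<close> by simp
  ultimately have "real d < 2 * real k" by simp
  then have "d < 2 * k" by linarith
  have "d < n" using \<open>d < 2 * k\<close> \<open>2 * k < n\<close> by simp
  then obtain I X z where I: "I \<subseteq> {..<n}" "card I = d" and X: "X \<subseteq> cube n" "finite X" "card X \<le> Suc d"
    and z: "\<forall>x\<in>X. \<forall>i\<in>{..<n} - I. x i = z i"
    and far: "\<forall>y\<in>cube n. \<exists>x\<in>X. hamming_dist n x y > k"
    by (rule sign_representable_GHD_uncentred[OF rep _ \<open>2 * k < n\<close>])
  have X01: "x i \<in> {0, 1}" if "x \<in> X" "i < n" for x i
    using that X(1) by (auto simp: cube_def PiE_iff)
  have "card X \<le> k\<^sup>2"
  proof -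
    have "2 * k \<le> k * k" using \<open>k \<ge> 2\<close> by (intro mult_right_mono) auto
    then show ?thesis unfolding power2_eq_square using X(3) \<open>d < 2 * k\<close> by linarith
  qed
  then have "real (card X) \<le> (real k)\<^sup>2" by (metis of_nat_le_iff of_nat_power)
  moreover have "finite I" using I(1) finite_subset by blast
  moreover have "x i \<in> {0, 1}" if "x \<in> X" "i \<in> I" for x i using X01 that I(1) by blast
  ultimately obtain y where y: "\<forall>i\<in>I. y i \<in> {0, 1}"
    "\<forall>x\<in>X. real (card {i\<in>I. x i \<noteq> y i}) \<le> d / 2 + (ln ((real k)\<^sup>2) / \<tau> + \<tau> * d) / 2"
    using ex_balanced_centre[of I X "(real k)\<^sup>2" \<tau>] X(2) I(2) lam by blast
  have radius: "d / 2 + (ln ((real k)\<^sup>2) / \<tau> + \<tau> * d) / 2 < k"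
  proof -
    have "ln ((real k)\<^sup>2) / \<tau> = 2 * (\<tau> * k)" using ln_eq \<open>k \<ge> 2\<close> by (simp add: ln_realpow)
    moreover have "\<tau> * d \<le> 2 * (\<tau> * k)"
      using mult_left_mono[of "real d" "2 * real k" \<tau>] \<open>real d < 2 * real k\<close> lam by simp
    ultimately show ?thesis using d by argo
  qed
  show False
  proof (cases "X = {}")
    case True
    moreover have "(\<lambda>i\<in>{..<n}. 0) \<in> cube n" by (simp add: cube_def)
    ultimately show False using far by blast
  next
    case False
    then obtain x0 where "x0 \<in> X" by blast
    define y' where "y' = (\<lambda>i\<in>{..<n}. if i \<in> I then y i else z i)"
    have "z i \<in> {0, 1}" if "i \<in> {..<n} - I" for i
      using X01[OF \<open>x0 \<in> X\<close>, of i] z \<open>x0 \<in> X\<close> that by auto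
    then have "y' \<in> cube n" using y(1) by (auto simp: y'_def cube_def)
    then obtain x where x: "x \<in> X" "hamming_dist n x y' > k" using far by blast
    have "{i. i < n \<and> x i \<noteq> y' i} = {i\<in>I. x i \<noteq> y i}"
      using z x(1) I(1) by (auto simp: y'_def)
    then show False using x(2) bspec[OF y(2) x(1)] radius by (simp add: hamming_dist_def)
  qed
qed

theorem theorem3:
  shows "\<exists>C::real. C > 0 \<and>
    (\<forall>(k::nat) (n::nat). k \<ge> 2 \<longrightarrow> real k < real n / 2 \<longrightarrow>
      real (sign_rank (cube n) (cube n) (GHD k n))
        \<ge> (1 - C * sqrt (ln (real k) / real k)) * (2 * real k))"
proof (intro exI[of _ 2] conjI allI impI)
  fix k n :: nat
  assume "k \<ge> 2" "real k < real n / 2"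
  moreover have "finite (cube n)" unfolding cube_def by (intro finite_PiE) auto
  ultimately show "real (sign_rank (cube n) (cube n) (GHD k n))
      \<ge> (1 - 2 * sqrt (ln (real k) / real k)) * (2 * real k)"
    by (intro sign_representable_GHD_bound[where n=n] sign_representable_sign_rank) linarith+
qed simp

end
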